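(* Let $(E,\mathcal{P})$ be a random locally convex module over $K$ with base $(\Omega,\mathcal{F},P)$, endowed with its $(\varepsilon,\lambda)$-topology, and let $G$ be an $L^0$-convex subset of $E$. If $G$ is $L^0$-convexly compact, then $G$ is almost surely bounded, i.e. for each $\|\cdot\|\in\mathcal{P}$ there exists $\xi\in L^0_+$ such that $\|g\|\le\xi$ for all $g\in G$.
   Context: $(\Omega,\mathcal{F},P)$ is a probability space, $K=\mathbb{R}$ or $\mathbb{C}$, $L^0(\mathcal{F},K)$ is the algebra of equivalence classes (modulo $P$-a.s. equality) of $K$-valued $\mathcal{F}$-measurable random variables, $L^0=L^0(\mathcal{F},\mathbb{R})$, ordered by $\xi\le\eta$ iff $\xi\le\eta$ a.s.; $L^0_+=\{\xi\in L^0:\xi\ge0\}$. An $L^0$-seminorm on an $L^0(\mathcal{F},K)$-module $E$ is a map $\|\cdot\|:E\to L^0_+$ with $\|\xi x\|=|\xi|\|x\|$ for $\xi\in L^0(\mathcal{F},K)$, $x\in E$, and $\|x+y\|\le\|x\|+\|y\|$. A random locally convex module $(E,\mathcal{P})$ over $K$ with base $(\Omega,\mathcal{F},P)$ is an $L^0(\mathcal{F},K)$-module $E$ with a family $\mathcal{P}$ of $L^0$-seminorms such that $\bigvee\{\|x\|:\|\cdot\|\in\mathcal{P}\}=0$ iff $x=\theta$ (the zero of $E$). For a finite nonempty $\mathcal{Q}\subset\mathcal{P}$ let $\|x\|_{\mathcal{Q}}=\bigvee_{\|\cdot\|\in\mathcal{Q}}\|x\|$; the $(\varepsilon,\lambda)$-topology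 is the linear topology on $E$ with local base at $\theta$ given by the sets $\{x\in E: P\{\omega:\|x\|_{\mathcal{Q}}(\omega)<\varepsilon\}>1-\lambda\}$, $\mathcal{Q}$ finite nonempty, $\varepsilon>0$, $0<\lambda<1$. A subset $G$ of $E$ is $L^0$-convex if $\xi x+(1-\xi)y\in G$ for all $x,y\in G$ and all $\xi\in L^0$ with $0\le\xi\le1$. An $L^0$-convex set $G$ is $L^0$-convexly compact if every family of $L^0$-convex subsets of $G$ which are closed (in the relative topology of $G$) and which has the finite intersection property has nonempty intersection. *)

theory Defs
  imports "HOL-Probability.Probability"
begin

text \<open>
Conventions.  The base probability space is M (prob_space M), with sample
points of type 'w.  An element of L0(F,K) is represented by a
representative, i.e. a Borel measurable function 'w => 'k; two
representatives denote the same element iff they agree M-almost everywhere.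
The scalar field K is a type 'k of class real_normed_field (every real normed
field with multiplicative norm is isometrically R or C).
The module E is the type 'e (an abelian group) with scalar action smul.
An L0-seminorm is represented by a map 'e => ('w => real) returning
representatives; all (in)equalities between L0 elements are almost sure.
\<close>

definition L0 :: "'w measure \<Rightarrow> ('w \<Rightarrow> 'k::real_normed_field) set" where
  "L0 M = borel_measurable M"

definition L0_module ::
  "'w measure \<Rightarrow> (('w \<Rightarrow> 'k::real_normed_field) \<Rightarrow> 'e::ab_group_add \<Rightarrow> 'e) \<Rightarrow> bool" where
  "L0_module M smul \<longleftrightarrow>
     (\<forall>\<xi>\<in>L0 M. \<forall>\<eta>\<in>L0 M. (AE \<omega> in M. \<xi> \<omega> = \<eta> \<omega>) \<longrightarrow> (\<forall>x. smul \<xi> x = smul \<eta> x)) \<and>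
     (\<forall>\<xi>\<in>L0 M. \<forall>x y. smul \<xi> (x + y) = smul \<xi> x + smul \<xi> y) \<and>
     (\<forall>\<xi>\<in>L0 M. \<forall>\<eta>\<in>L0 M. \<forall>x. smul (\<lambda>\<omega>. \<xi> \<omega> + \<eta> \<omega>) x = smul \<xi> x + smul \<eta> x) \<and>
     (\<forall>\<xi>\<in>L0 M. \<forall>\<eta>\<in>L0 M. \<forall>x. smul (\<lambda>\<omega>. \<xi> \<omega> * \<eta> \<omega>) x = smul \<xi> (smul \<eta> x)) \<and>
     (\<forall>x. smul (\<lambda>\<omega>. 1) x = x)"

definition L0_seminorm ::
  "'w measure \<Rightarrow> (('w \<Rightarrow> 'k::real_normed_field) \<Rightarrow> 'e::ab_group_add \<Rightarrow> 'e) \<Rightarrow> ('e \<Rightarrow> 'w \<Rightarrow> real) \<Rightarrow> bool" where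
  "L0_seminorm M smul nrm \<longleftrightarrow>
     (\<forall>x. nrm x \<in> borel_measurable M \<and> (AE \<omega> in M. 0 \<le> nrm x \<omega>)) \<and>
     (\<forall>\<xi>\<in>L0 M. \<forall>x. AE \<omega> in M. nrm (smul \<xi> x) \<omega> = norm (\<xi> \<omega>) * nrm x \<omega>) \<and>
     (\<forall>x y. AE \<omega> in M. nrm (x + y) \<omega> \<le> nrm x \<omega> + nrm y \<omega>)"

text \<open>Random locally convex module (E,P) over K with base M.  Since all
seminorms are nonnegative, the L0-supremum of the family of the ||x|| is 0
iff every ||x|| is 0 a.s.\<close>
definition RLC_module ::
  "'w measure \<Rightarrow> (('w \<Rightarrow> 'k::real_normed_field) \<Rightarrow> 'e::ab_group_add \<Rightarrow> 'e) \<Rightarrow> ('e \<Rightarrow> 'w \<Rightarrow> real) set \<Rightarrow> bool" where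
  "RLC_module M smul \<P> \<longleftrightarrow>
     prob_space M \<and> L0_module M smul \<and> (\<forall>p\<in>\<P>. L0_seminorm M smul p) \<and>
     (\<forall>x. (\<forall>p\<in>\<P>. AE \<omega> in M. p x \<omega> = 0) \<longleftrightarrow> x = 0)"

definition el_nbhd ::
  "'w measure \<Rightarrow> 'e::ab_group_add \<Rightarrow> ('e \<Rightarrow> 'w \<Rightarrow> real) set \<Rightarrow> real \<Rightarrow> real \<Rightarrow> 'e set" where
  "el_nbhd M x Q \<epsilon> lam =
     {y. measure M {\<omega>\<in>space M. Max ((\<lambda>p. p (y - x) \<omega>) ` Q) < \<epsilon>} > 1 - lam}"

definition el_open :: "'w measure \<Rightarrow> ('e::ab_group_add \<Rightarrow> 'w \<Rightarrow> real) set \<Rightarrow> 'e set \<Rightarrow> bool" where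
  "el_open M \<P> U \<longleftrightarrow>
     (\<forall>x\<in>U. \<exists>Q \<epsilon> lam. finite Q \<and> Q \<noteq> {} \<and> Q \<subseteq> \<P> \<and> 0 < \<epsilon> \<and> 0 < lam \<and> lam < 1 \<and>
        el_nbhd M x Q \<epsilon> lam \<subseteq> U)"

definition el_closed :: "'w measure \<Rightarrow> ('e::ab_group_add \<Rightarrow> 'w \<Rightarrow> real) set \<Rightarrow> 'e set \<Rightarrow> bool" where
  "el_closed M \<P> C \<longleftrightarrow> el_open M \<P> (- C)"

definition el_closed_in :: "'w measure \<Rightarrow> ('e::ab_group_add \<Rightarrow> 'w \<Rightarrow> real) set \<Rightarrow> 'e set \<Rightarrow> 'e set \<Rightarrow> bool" where
  "el_closed_in M \<P> G F \<longleftrightarrow> (\<exists>C. el_closed M \<P> C \<and> F = G \<inter> C)"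

definition L0_convex ::
  "'w measure \<Rightarrow> (('w \<Rightarrow> 'k::real_normed_field) \<Rightarrow> 'e::ab_group_add \<Rightarrow> 'e) \<Rightarrow> 'e set \<Rightarrow> bool" where
  "L0_convex M smul G \<longleftrightarrow>
     (\<forall>x\<in>G. \<forall>y\<in>G. \<forall>\<xi>\<in>borel_measurable M. (AE \<omega> in M. 0 \<le> \<xi> \<omega> \<and> \<xi> \<omega> \<le> 1) \<longrightarrow>
        smul (\<lambda>\<omega>. of_real (\<xi> \<omega>)) x + smul (\<lambda>\<omega>. of_real (1 - \<xi> \<omega>)) y \<in> G)"

definition L0_convexly_compact ::
  "'w measure \<Rightarrow> (('w \<Rightarrow> 'k::real_normed_field) \<Rightarrow> 'e::ab_group_add \<Rightarrow> 'e) \<Rightarrow> ('e \<Rightarrow> 'w \<Rightarrow> real) set \<Rightarrow> 'e set \<Rightarrow> bool" where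
  "L0_convexly_compact M smul \<P> G \<longleftrightarrow>
     L0_convex M smul G \<and>
     (\<forall>\<F>. (\<forall>F\<in>\<F>. F \<subseteq> G \<and> L0_convex M smul F \<and> el_closed_in M \<P> G F) \<and>
          (\<forall>\<F>'. \<F>' \<subseteq> \<F> \<and> finite \<F>' \<and> \<F>' \<noteq> {} \<longrightarrow> \<Inter>\<F>' \<noteq> {})
          \<longrightarrow> \<Inter>\<F> \<noteq> {})"

end

theory Submission
  imports Defs
begin

text \<open>
  Only one seminorm \<open>p\<close> and real scalars matter, and no duality is needed. Gluing two elements of \<open>G\<close>
  along an event shows that the functions \<open>p g\<close> form an upward directed family, so it suffices to
  bound them in probability. If they are unbounded in probability, one builds decreasing closed
  \<open>L\<^sup>0\<close>-convex sets \<open>F n\<close>, each a homothetic copy of \<open>G\<close>: given \<open>F n\<close>, pick \<open>s\<close> in it with \<open>p s\<close> large,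
  and contract \<open>F n\<close> towards \<open>s\<close> by a factor so small that \<open>p\<close> stays large, with probability bounded
  below, on all of \<open>F (n + 1)\<close>. A point common to all \<open>F n\<close> cannot exist. Were no factor small enough,
  compactness would give a point \<open>w\<close> with \<open>p (w - s) \<noteq> 0\<close> that lies in all contractions, so that \<open>G\<close>
  would contain the ray from \<open>s\<close> through \<open>w\<close>; the sublevel sets of its Busemann function then violate
  compactness.
\<close>

section \<open>Calculus of one random seminorm over real scalars\<close>

lemma L0_moduleD:
  assumes "L0_module M smul" and "\<xi> \<in> L0 M"
  shows "\<eta> \<in> L0 M \<Longrightarrow> AE \<omega> in M. \<xi> \<omega> = \<eta> \<omega> \<Longrightarrow> smul \<xi> x = smul \<eta> x"
    and "smul \<xi> (x + y) = smul \<xi> x + smul \<xi> y"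
    and "\<eta> \<in> L0 M \<Longrightarrow> smul (\<lambda>\<omega>. \<xi> \<omega> + \<eta> \<omega>) x = smul \<xi> x + smul \<eta> x"
    and "\<eta> \<in> L0 M \<Longrightarrow> smul (\<lambda>\<omega>. \<xi> \<omega> * \<eta> \<omega>) x = smul \<xi> (smul \<eta> x)"
    and "smul (\<lambda>\<omega>. 1) x = x"
proof -
  note m = assms(1)[unfolded L0_module_def]
  show "\<eta> \<in> L0 M \<Longrightarrow> AE \<omega> in M. \<xi> \<omega> = \<eta> \<omega> \<Longrightarrow> smul \<xi> x = smul \<eta> x"
    using m[THEN conjunct1] assms(2) by blast
  show "smul \<xi> (x + y) = smul \<xi> x + smul \<xi> y"
    using m[THEN conjunct2, THEN conjunct1] assms(2) by blast
  show "\<eta> \<in> L0 M \<Longrightarrow> smul (\<lambda>\<omega>. \<xi> \<omega> + \<eta> \<omega>) x = smul \<xi> x + smul \<eta> x"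
    using m[THEN conjunct2, THEN conjunct2, THEN conjunct1] assms(2) by blast
  show "\<eta> \<in> L0 M \<Longrightarrow> smul (\<lambda>\<omega>. \<xi> \<omega> * \<eta> \<omega>) x = smul \<xi> (smul \<eta> x)"
    using m[THEN conjunct2, THEN conjunct2, THEN conjunct2, THEN conjunct1] assms(2) by blast
  show "smul (\<lambda>\<omega>. 1) x = x"
    using m[THEN conjunct2, THEN conjunct2, THEN conjunct2, THEN conjunct2] by blast
qed

text \<open>Real scalars suffice even for complex \<open>K\<close>, because \<open>L0_convex\<close>
  only uses real coefficients; the given action enters by restriction of scalars along
  \<open>of_real\<close>.\<close>

locale random_seminorm = prob_space M for M :: "'w measure" +
  fixes act :: "('w \<Rightarrow> real) \<Rightarrow> 'e::ab_group_add \<Rightarrow> 'e"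
    and p :: "'e \<Rightarrow> 'w \<Rightarrow> real"
  assumes module: "L0_module M act"
    and seminorm: "L0_seminorm M act p"
begin

lemma act_add_right: "\<xi> \<in> borel_measurable M \<Longrightarrow> act \<xi> (x + y) = act \<xi> x + act \<xi> y"
  by (rule L0_moduleD(2)[OF module]) (simp add: L0_def)

lemma act_add_left:
  "\<xi> \<in> borel_measurable M \<Longrightarrow> \<eta> \<in> borel_measurable M \<Longrightarrow>
    act (\<lambda>\<omega>. \<xi> \<omega> + \<eta> \<omega>) x = act \<xi> x + act \<eta> x"
  by (rule L0_moduleD(3)[OF module]) (simp_all add: L0_def)

lemma act_act:
  "\<xi> \<in> borel_measurable M \<Longrightarrow> \<eta> \<in> borel_measurable M \<Longrightarrow>
    act \<xi> (act \<eta> x) = act (\<lambda>\<omega>. \<xi> \<omega> * \<eta> \<omega>) x"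
  by (rule L0_moduleD(4)[OF module, symmetric]) (simp_all add: L0_def)

lemma act_cong_AE:
  "\<xi> \<in> borel_measurable M \<Longrightarrow> \<eta> \<in> borel_measurable M \<Longrightarrow> AE \<omega> in M. \<xi> \<omega> = \<eta> \<omega> \<Longrightarrow>
    act \<xi> x = act \<eta> x"
  by (rule L0_moduleD(1)[OF module]) (simp_all add: L0_def)

lemma act_one: "act (\<lambda>\<omega>. 1) x = x"
  by (rule L0_moduleD(5)[OF module, of "\<lambda>_. 0"]) (simp add: L0_def)

definition scal :: "real \<Rightarrow> 'e \<Rightarrow> 'e" where
  "scal c x = act (\<lambda>_. c) x"

text \<open>Constant coefficients make the module a real vector space, so identities between
  homotheties can be left to the library.\<close>

sublocale scal: module scal
proof
  show "scal (a + b) x = scal a x + scal b x" for a b x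
    using act_add_left[of "\<lambda>_. a" "\<lambda>_. b" x] by (simp add: scal_def)
qed (simp_all add: scal_def act_add_right act_act act_one)

lemma act_zero_left: "act (\<lambda>_. 0) x = 0"
  using scal.scale_zero_left by (simp add: scal_def)

lemma act_diff_right:
  assumes "\<xi> \<in> borel_measurable M"
  shows "act \<xi> (x - y) = act \<xi> x - act \<xi> y"
  using act_add_right[OF assms, of "x - y" y] by simp

lemma act_scal:
  assumes "\<xi> \<in> borel_measurable M"
  shows "act \<xi> (scal c x) = scal c (act \<xi> x)"
  using assms by (simp add: scal_def act_act mult.commute)

lemma act_complement:
  assumes "\<xi> \<in> borel_measurable M"
  shows "act \<xi> u + act (\<lambda>\<omega>. 1 - \<xi> \<omega>) u = u"
  using act_add_left[of \<xi> "\<lambda>\<omega>. 1 - \<xi> \<omega>" u] assms by (simp add: act_one)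

lemma measurable_p [measurable]: "p x \<in> borel_measurable M"
  using seminorm by (auto simp: L0_seminorm_def)

lemma p_nonneg: "AE \<omega> in M. 0 \<le> p x \<omega>"
  using seminorm by (auto simp: L0_seminorm_def)

lemma p_act:
  "\<xi> \<in> borel_measurable M \<Longrightarrow> AE \<omega> in M. p (act \<xi> x) \<omega> = \<bar>\<xi> \<omega>\<bar> * p x \<omega>"
  using seminorm by (auto simp: L0_seminorm_def L0_def)

lemma p_scal: "AE \<omega> in M. p (scal c x) \<omega> = \<bar>c\<bar> * p x \<omega>"
  unfolding scal_def by (rule p_act) simp

lemma p_triangle: "AE \<omega> in M. p (x + y) \<omega> \<le> p x \<omega> + p y \<omega>"
  using seminorm by (auto simp: L0_seminorm_def)

lemma p_zero: "AE \<omega> in M. p 0 \<omega> = 0"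
  using p_scal[of 0 0] by simp

lemma p_minus_commute: "AE \<omega> in M. p (x - y) \<omega> = p (y - x) \<omega>"
  using p_scal[of "-1" "y - x"] by simp

lemma p_triangle_diff: "AE \<omega> in M. p (x - z) \<omega> \<le> p (x - y) \<omega> + p (y - z) \<omega>"
  using p_triangle[of "x - y" "y - z"] by simp

lemma p_le_diff: "AE \<omega> in M. p x \<omega> \<le> p y \<omega> + p (x - y) \<omega>"
  using p_triangle[of y "x - y"] by simp

text \<open>By \<open>act_complement\<close>, \<open>u\<close> is the combination of itself with
  itself; the difference therefore splits and the triangle inequality applies.\<close>

lemma p_convex:
  assumes [measurable]: "\<xi> \<in> borel_measurable M" and "AE \<omega> in M. 0 \<le> \<xi> \<omega> \<and> \<xi> \<omega> \<le> 1"
  shows "AE \<omega> in M. p (act \<xi> x + act (\<lambda>\<omega>. 1 - \<xi> \<omega>) y - u) \<omega>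
    \<le> \<xi> \<omega> * p (x - u) \<omega> + (1 - \<xi> \<omega>) * p (y - u) \<omega>"
proof -
  have m: "(\<lambda>\<omega>. 1 - \<xi> \<omega>) \<in> borel_measurable M" by measurable
  have eq: "act \<xi> x + act (\<lambda>\<omega>. 1 - \<xi> \<omega>) y - u
      = act \<xi> (x - u) + act (\<lambda>\<omega>. 1 - \<xi> \<omega>) (y - u)"
    using act_complement[OF assms(1), of u]
    by (simp add: act_diff_right m assms(1) algebra_simps)
  show ?thesis
    unfolding eq
    using assms(2) p_triangle[of "act \<xi> (x - u)" "act (\<lambda>\<omega>. 1 - \<xi> \<omega>) (y - u)"]
      p_act[OF assms(1), of "x - u"] p_act[OF m, of "y - u"]
    by eventually_elim auto
qed

section \<open>Gluing along events\<close>

definition glue :: "'w set \<Rightarrow> 'e \<Rightarrow> 'e \<Rightarrow> 'e" where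
  "glue A x y = act (indicator A) x + act (\<lambda>\<omega>. 1 - indicator A \<omega>) y"

lemma convexD:
  assumes "L0_convex M act C" "x \<in> C" "y \<in> C" "\<xi> \<in> borel_measurable M"
    and "AE \<omega> in M. 0 \<le> \<xi> \<omega> \<and> \<xi> \<omega> \<le> 1"
  shows "act \<xi> x + act (\<lambda>\<omega>. 1 - \<xi> \<omega>) y \<in> C"
  using assms by (auto simp: L0_convex_def)

lemma convexI:
  assumes "\<And>x y \<xi>. x \<in> C \<Longrightarrow> y \<in> C \<Longrightarrow> \<xi> \<in> borel_measurable M \<Longrightarrow>
    AE \<omega> in M. 0 \<le> \<xi> \<omega> \<and> \<xi> \<omega> \<le> 1 \<Longrightarrow> act \<xi> x + act (\<lambda>\<omega>. 1 - \<xi> \<omega>) y \<in> C"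
  shows "L0_convex M act C"
  using assms by (auto simp: L0_convex_def)

text \<open>An indicator is an admissible coefficient; convexity with constant coefficients alone
  would not give this stability.\<close>

lemma glue_in_convex:
  assumes "L0_convex M act C" "x \<in> C" "y \<in> C" "A \<in> sets M"
  shows "glue A x y \<in> C"
  unfolding glue_def using assms by (intro convexD) auto

text \<open>The seminorm is local: \<open>p (act (indicator A) x)\<close> agrees with
  \<open>p x\<close> on \<open>A\<close>, so only the part of \<open>x\<close> cut out by
  \<open>A\<close> matters there.\<close>

lemma p_eq_on:
  assumes [measurable]: "A \<in> sets M" and "act (indicator A) x = act (indicator A) y"
  shows "AE \<omega> in M. \<omega> \<in> A \<longrightarrow> p x \<omega> = p y \<omega>"
  using p_act[of "indicator A" x] p_act[of "indicator A" y] assms(2)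
  by (auto elim!: eventually_elim2 split: split_indicator_asm)

lemma p_glue:
  assumes [measurable]: "A \<in> sets M"
  shows "AE \<omega> in M. p (glue A x y - u) \<omega> = (if \<omega> \<in> A then p (x - u) \<omega> else p (y - u) \<omega>)"
proof -
  let ?i = "indicator A :: 'w \<Rightarrow> real" and ?j = "indicator (space M - A) :: 'w \<Rightarrow> real"
  \<comment> \<open>The two functions differ off \<open>space M\<close>, hence the detour through
    almost everywhere equality.\<close>
  have comp: "act (\<lambda>\<omega>. 1 - ?i \<omega>) z = act ?j z" for z
    by (rule act_cong_AE) (auto split: split_indicator)
  have mult: "(\<lambda>\<omega>. ?i \<omega> * ?i \<omega>) = ?i" "(\<lambda>\<omega>. ?j \<omega> * ?j \<omega>) = ?j"
    "(\<lambda>\<omega>. ?i \<omega> * ?j \<omega>) = (\<lambda>_. 0)" "(\<lambda>\<omega>. ?j \<omega> * ?i \<omega>) = (\<lambda>_. 0)"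
    by (auto split: split_indicator)
  have "act ?i (glue A x y - u) = act ?i (x - u)" "act ?j (glue A x y - u) = act ?j (y - u)"
    by (simp_all add: glue_def comp act_diff_right act_add_right act_act mult act_zero_left)
  then have "AE \<omega> in M. \<omega> \<in> A \<longrightarrow> p (glue A x y - u) \<omega> = p (x - u) \<omega>"
    and "AE \<omega> in M. \<omega> \<in> space M - A \<longrightarrow> p (glue A x y - u) \<omega> = p (y - u) \<omega>"
    using p_eq_on[of A "glue A x y - u" "x - u"]
      p_eq_on[of "space M - A" "glue A x y - u" "y - u"] by (simp_all del: Diff_iff)
  with AE_space show ?thesis
    by eventually_elim auto
qed

text \<open>Overlaps are harmless: on an overlap each witness satisfies \<open>R\<close>, so the one
  glued last may win there.\<close>

lemma glue_union:
  assumes C: "L0_convex M act C" and [measurable]: "\<And>i::nat. D i \<in> sets M"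
    and z: "\<And>i. i \<in> I \<Longrightarrow> z i \<in> C"
      "\<And>i. i \<in> I \<Longrightarrow> AE \<omega> in M. \<omega> \<in> D i \<longrightarrow> R \<omega> (p (z i - u) \<omega>)"
    and "finite I" "I \<noteq> {}"
  shows "\<exists>y\<in>C. AE \<omega> in M. \<omega> \<in> (\<Union>i\<in>I. D i) \<longrightarrow> R \<omega> (p (y - u) \<omega>)"
  using assms(5,6) z
proof (induction I rule: finite_ne_induct)
  case (singleton i)
  then show ?case by auto
next
  case (insert i I)
  then obtain y where y: "y \<in> C" "AE \<omega> in M. \<omega> \<in> (\<Union>i\<in>I. D i) \<longrightarrow> R \<omega> (p (y - u) \<omega>)"
    by auto
  have "glue (D i) (z i) y \<in> C"
    using insert.prems y C by (intro glue_in_convex) auto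
  moreover have "AE \<omega> in M. \<omega> \<in> (\<Union>i\<in>insert i I. D i) \<longrightarrow> R \<omega> (p (glue (D i) (z i) y - u) \<omega>)"
    using y(2) insert.prems(2)[of i, simplified] p_glue[of "D i" "z i" y u, simplified]
    by eventually_elim auto
  ultimately show ?case by blast
qed

text \<open>An Egorov-type principle: since the \<open>z k\<close> can be glued, events of probability at least \<open>\<eta>\<close>
  that vary with \<open>k\<close> may be replaced by a single one, at an arbitrarily small cost.\<close>

lemma common_event:
  assumes C: "decseq C" "\<And>k. L0_convex M act (C k)"
    and [measurable]: "\<And>k. D k \<in> sets M" and D: "\<And>k. \<eta> \<le> prob (D k)"
    and z: "\<And>k. z k \<in> C k" "\<And>k. AE \<omega> in M. \<omega> \<in> D k \<longrightarrow> R \<omega> (p (z k - u) \<omega>)"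
    and "\<eta>' < \<eta>"
  obtains B where "B \<in> sets M" "\<eta>' \<le> prob B"
    "\<And>k. \<exists>y\<in>C k. AE \<omega> in M. \<omega> \<in> B \<longrightarrow> R \<omega> (p (y - u) \<omega>)"
proof -
  define \<delta> where "\<delta> = \<eta> - \<eta>'"
  have "\<delta> > 0" using assms(7) by (simp add: \<delta>_def)
  \<comment> \<open>The tails \<open>U k\<close> decrease, so their intersection, the limsup of the
    \<open>D k\<close>, still has probability at least \<open>\<eta>\<close>. Cutting the
    \<open>k\<close>-th tail to a finite union costs less than \<open>\<delta> / 2^(k+1)\<close>,
    hence at most \<open>\<delta>\<close> in total.\<close>
  define U where "U k = (\<Union>j\<in>{k..}. D j)" for k
  have [measurable]: "U k \<in> sets M" for k unfolding U_def by measurable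
  have "\<exists>J\<ge>k. prob (U k - (\<Union>j\<in>{k..J}. D j)) < \<delta> * (1/2)^(Suc k)" for k
  proof -
    have "(\<lambda>J. prob (\<Union>j\<in>{k..J}. D j)) \<longlonglongrightarrow> prob (\<Union>J. \<Union>j\<in>{k..J}. D j)"
      by (intro finite_Lim_measure_incseq) (auto simp: incseq_def, fastforce)
    also have "(\<Union>J. \<Union>j\<in>{k..J}. D j) = U k"
      by (auto simp: U_def) (metis atLeastAtMost_iff order_refl)
    finally have "(\<lambda>J. prob (U k) - prob (\<Union>j\<in>{k..J}. D j)) \<longlonglongrightarrow> prob (U k) - prob (U k)"
      by (intro tendsto_intros)
    then have "eventually (\<lambda>J. prob (U k) - prob (\<Union>j\<in>{k..J}. D j) < \<delta> * (1/2)^(Suc k)) sequentially"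
      using \<open>\<delta> > 0\<close> by (intro order_tendstoD) auto
    then have "eventually (\<lambda>J. prob (U k) - prob (\<Union>j\<in>{k..J}. D j) < \<delta> * (1/2)^(Suc k) \<and> J \<ge> k) sequentially"
      using eventually_ge_at_top[of k] by eventually_elim auto
    then obtain J where "J \<ge> k" "prob (U k) - prob (\<Union>j\<in>{k..J}. D j) < \<delta> * (1/2)^(Suc k)"
      by (auto simp: eventually_sequentially)
    moreover have "prob (U k - (\<Union>j\<in>{k..J}. D j)) = prob (U k) - prob (\<Union>j\<in>{k..J}. D j)"
      by (intro finite_measure_Diff) (auto simp: U_def)
    ultimately show ?thesis by auto
  qed
  then obtain J where J: "\<And>k. J k \<ge> k"
    "\<And>k. prob (U k - (\<Union>j\<in>{k..J k}. D j)) < \<delta> * (1/2)^(Suc k)"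
    by metis
  define E where "E k = (\<Union>j\<in>{k..J k}. D j)" for k
  have [measurable]: "E k \<in> sets M" for k unfolding E_def by measurable
  define B where "B = (\<Inter>k. E k)"
  have [measurable]: "B \<in> sets M" unfolding B_def by measurable
  have "(\<lambda>k. prob (U k)) \<longlonglongrightarrow> prob (\<Inter>k. U k)"
    by (intro finite_Lim_measure_decseq) (auto simp: decseq_def U_def, force)
  moreover have "\<eta> \<le> prob (U k)" for k
    using D[of k] by (rule order_trans) (auto intro!: finite_measure_mono simp: U_def)
  ultimately have "\<eta> \<le> prob (\<Inter>k. U k)"
    by (intro LIMSEQ_le_const) auto
  also have "\<dots> \<le> prob (B \<union> (\<Union>k. U k - E k))"
    by (intro finite_measure_mono) (auto simp: B_def)
  also have "\<dots> \<le> prob B + prob (\<Union>k. U k - E k)"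
    by (intro measure_Un_le) auto
  also have "prob (\<Union>k. U k - E k) \<le> (\<Sum>k. \<delta> * (1/2)^(Suc k))"
  proof -
    have s: "summable (\<lambda>k. \<delta> * (1/2::real)^(Suc k))"
      by (intro summable_mult) (simp add: summable_Suc_iff)
    have s': "summable (\<lambda>k. prob (U k - E k))"
      by (rule summable_comparison_test[OF _ s])
        (use J(2) in \<open>auto simp: E_def intro!: exI[of _ 0] less_imp_le\<close>)
    have "prob (\<Union>k. U k - E k) \<le> (\<Sum>k. prob (U k - E k))"
      by (intro finite_measure_subadditive_countably s') auto
    also have "\<dots> \<le> (\<Sum>k. \<delta> * (1/2)^(Suc k))"
      by (intro suminf_le s s') (use J(2) in \<open>auto simp: E_def intro: less_imp_le\<close>)
    finally show ?thesis .
  qed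
  also have "(\<Sum>k. \<delta> * (1/2)^(Suc k)) = \<delta>"
    using power_half_series by (intro sums_unique[symmetric]) (use sums_mult[OF power_half_series, of \<delta>] in simp)
  finally have "\<eta>' \<le> prob B" by (simp add: \<delta>_def)
  moreover have "\<exists>y\<in>C k. AE \<omega> in M. \<omega> \<in> B \<longrightarrow> R \<omega> (p (y - u) \<omega>)" for k
  proof -
    have "\<exists>y\<in>C k. AE \<omega> in M. \<omega> \<in> (\<Union>j\<in>{k..J k}. D j) \<longrightarrow> R \<omega> (p (y - u) \<omega>)"
    \<comment> \<open>Only indices \<open>j \<ge> k\<close> are glued, and
      \<open>C j \<subseteq> C k\<close> for these.\<close>
    proof (rule glue_union[OF C(2), where z = z])
      show "z j \<in> C k" if "j \<in> {k..J k}" for j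
        using that z(1)[of j] decseqD[OF C(1), of k j] by auto
    qed (use z(2) J(1)[of k] in auto)
    then show ?thesis by (auto simp: B_def E_def elim!: eventually_mono)
  qed
  ultimately show ?thesis using that[of B] by auto
qed

section \<open>Closedness and convexity for a single seminorm\<close>

text \<open>Closedness under convergence in probability for the pseudometric of \<open>p\<close>; as
  in the Ky Fan metric, one \<open>\<epsilon>\<close> measures both the distance and the exceptional
  probability.\<close>

definition p_closed :: "'e set \<Rightarrow> bool" where
  "p_closed C \<longleftrightarrow>
    (\<forall>u. (\<forall>\<epsilon>>0. \<exists>y\<in>C. prob {\<omega>\<in>space M. \<epsilon> \<le> p (y - u) \<omega>} < \<epsilon>) \<longrightarrow> u \<in> C)"

lemma p_closedD:
  assumes "p_closed C" "\<And>\<epsilon>. \<epsilon> > 0 \<Longrightarrow> \<exists>y\<in>C. prob {\<omega>\<in>space M. \<epsilon> \<le> p (y - u) \<omega>} < \<epsilon>"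
  shows "u \<in> C"
  using assms by (auto simp: p_closed_def)

lemma p_closed_Int: "p_closed C \<Longrightarrow> p_closed D \<Longrightarrow> p_closed (C \<inter> D)"
  unfolding p_closed_def by (metis IntE IntI)

lemma L0_convex_Int: "L0_convex M act C \<Longrightarrow> L0_convex M act D \<Longrightarrow> L0_convex M act (C \<inter> D)"
  unfolding L0_convex_def by auto

text \<open>The neighbourhoods given by \<open>Q = {p}\<close> alone already separate a point from
  the set.\<close>

lemma p_closed_imp_el_closed:
  assumes "p_closed C" "p \<in> \<P>"
  shows "el_closed M \<P> C"
  unfolding el_closed_def el_open_def
proof
  fix u assume "u \<in> - C"
  with assms(1) obtain \<epsilon> where e: "\<epsilon> > 0" "\<And>y. y \<in> C \<Longrightarrow> \<not> prob {\<omega>\<in>space M. \<epsilon> \<le> p (y - u) \<omega>} < \<epsilon>"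
    unfolding p_closed_def by blast
  \<comment> \<open>\<open>el_open\<close> demands \<open>lam < 1\<close> while
    \<open>\<epsilon>\<close> may be large, hence the cap at 1/2.\<close>
  have "el_nbhd M u {p} \<epsilon> (min \<epsilon> (1/2)) \<subseteq> - C"
  proof
    fix y assume "y \<in> el_nbhd M u {p} \<epsilon> (min \<epsilon> (1/2))"
    then have "prob {\<omega>\<in>space M. p (y - u) \<omega> < \<epsilon>} > 1 - min \<epsilon> (1/2)"
      by (simp add: el_nbhd_def)
    moreover have "prob {\<omega>\<in>space M. \<not> p (y - u) \<omega> < \<epsilon>} = 1 - prob {\<omega>\<in>space M. p (y - u) \<omega> < \<epsilon>}"
      by (intro prob_neg) measurable
    ultimately have "prob {\<omega>\<in>space M. \<epsilon> \<le> p (y - u) \<omega>} < \<epsilon>"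
      by (simp add: not_less)
    with e(2) show "y \<in> - C" by auto
  qed
  then show "\<exists>Q \<epsilon> lam. finite Q \<and> Q \<noteq> {} \<and> Q \<subseteq> \<P> \<and> 0 < \<epsilon> \<and> 0 < lam \<and> lam < 1 \<and>
      el_nbhd M u Q \<epsilon> lam \<subseteq> - C"
    using e(1) assms(2) by (intro exI[of _ "{p}"] exI[of _ \<epsilon>] exI[of _ "min \<epsilon> (1/2)"]) auto
qed

lemma p_closed_null:
  assumes "p_closed C" "y \<in> C" "AE \<omega> in M. p (y - u) \<omega> = 0"
  shows "u \<in> C"
proof (rule p_closedD[OF assms(1)])
  fix \<epsilon> :: real assume "\<epsilon> > 0"
  with assms(3) have "AE \<omega> in M. \<not> \<epsilon> \<le> p (y - u) \<omega>" by (auto elim: eventually_mono)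
  then have "prob {\<omega>\<in>space M. \<epsilon> \<le> p (y - u) \<omega>} = 0"
    by (subst prob_eq_0) auto
  with assms(2) \<open>\<epsilon> > 0\<close> show "\<exists>y\<in>C. prob {\<omega>\<in>space M. \<epsilon> \<le> p (y - u) \<omega>} < \<epsilon>"
    by (intro bexI[of _ y]) auto
qed

text \<open>A function that is 1-Lipschitz for \<open>p\<close> carries an almost sure bound over to
  limits in probability. Balls and Busemann functions are the two applications.\<close>

lemma p_closed_sublevel:
  fixes c :: "'w \<Rightarrow> real"
  assumes b: "\<And>u. b u \<in> borel_measurable M" "\<And>u v. AE \<omega> in M. b u \<omega> \<le> b v \<omega> + p (v - u) \<omega>"
    and c [measurable]: "c \<in> borel_measurable M" and [measurable]: "D \<in> sets M"
  shows "p_closed {u. AE \<omega> in M. \<omega> \<in> D \<longrightarrow> b u \<omega> \<le> c \<omega>}" (is "p_closed ?C")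
  unfolding p_closed_def
proof (intro allI impI)
  fix u assume u: "\<forall>\<epsilon>>0. \<exists>y\<in>?C. prob {\<omega>\<in>space M. \<epsilon> \<le> p (y - u) \<omega>} < \<epsilon>"
  note [measurable] = b(1)
  \<comment> \<open>For every \<open>y\<close> in the set,
    \<open>p (y - u) \<ge> 1 / (n + 1)\<close> almost surely on \<open>?E n\<close>; a suitable
    \<open>y\<close> makes this as improbable as desired.\<close>
  let ?E = "\<lambda>n. {\<omega>\<in>space M. \<omega> \<in> D \<and> c \<omega> + 1 / real (Suc n) \<le> b u \<omega>}"
  have le: "prob (?E n) \<le> \<epsilon>" if "0 < \<epsilon>" "\<epsilon> \<le> 1 / real (Suc n)" for \<epsilon> n
  proof -
    obtain y where y: "y \<in> ?C" "prob {\<omega>\<in>space M. \<epsilon> \<le> p (y - u) \<omega>} < \<epsilon>" using u \<open>0 < \<epsilon>\<close> by auto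
    have "prob (?E n) \<le> prob {\<omega>\<in>space M. \<epsilon> \<le> p (y - u) \<omega>}"
    proof (rule finite_measure_mono_AE)
      show "AE \<omega> in M. \<omega> \<in> ?E n \<longrightarrow> \<omega> \<in> {\<omega> \<in> space M. \<epsilon> \<le> p (y - u) \<omega>}"
        using y(1)[simplified] b(2)[of u y] by eventually_elim (use that(2) in auto)
    qed measurable
    with y(2) show ?thesis by simp
  qed
  have "prob (?E n) = 0" for n
  proof (rule ccontr)
    assume "prob (?E n) \<noteq> 0"
    then have pos: "0 < prob (?E n)" by (simp add: zero_less_measure_iff)
    define \<epsilon> where "\<epsilon> = min (prob (?E n) / 2) (1 / real (Suc n))"
    have "0 < \<epsilon>" "\<epsilon> \<le> 1 / real (Suc n)" "\<epsilon> < prob (?E n)" using pos by (auto simp: \<epsilon>_def)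
    then show False using le[of \<epsilon> n] by simp
  qed
  then have "AE \<omega> in M. \<not> (\<omega> \<in> D \<and> c \<omega> + 1 / real (Suc n) \<le> b u \<omega>)" for n
    using prob_eq_0[of "?E n"] by (auto elim: eventually_rev_mp)
  then have "AE \<omega> in M. \<forall>n. \<not> (\<omega> \<in> D \<and> c \<omega> + 1 / real (Suc n) \<le> b u \<omega>)"
    by (subst AE_all_countable) auto
  then have "AE \<omega> in M. \<omega> \<in> D \<longrightarrow> b u \<omega> \<le> c \<omega>"
  proof eventually_elim
    case (elim \<omega>)
    show ?case
    proof (rule impI, rule ccontr)
      assume "\<omega> \<in> D" "\<not> b u \<omega> \<le> c \<omega>"
      then obtain n where "1 / real (Suc n) < b u \<omega> - c \<omega>"
        using nat_approx_posE[of "b u \<omega> - c \<omega>"] by auto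
      with elim \<open>\<omega> \<in> D\<close> show False by (auto dest: spec[of _ n])
    qed
  qed
  then show "u \<in> ?C" by simp
qed

lemma L0_convex_sublevel:
  assumes "\<And>x y \<xi>. \<xi> \<in> borel_measurable M \<Longrightarrow> AE \<omega> in M. 0 \<le> \<xi> \<omega> \<and> \<xi> \<omega> \<le> 1 \<Longrightarrow>
    AE \<omega> in M. b (act \<xi> x + act (\<lambda>\<omega>. 1 - \<xi> \<omega>) y) \<omega> \<le> \<xi> \<omega> * b x \<omega> + (1 - \<xi> \<omega>) * b y \<omega>"
  shows "L0_convex M act {u. AE \<omega> in M. \<omega> \<in> D \<longrightarrow> b u \<omega> \<le> c \<omega>}"
proof (rule convexI)
  fix x y and \<xi> :: "'w \<Rightarrow> real"
  assume xy: "x \<in> {u. AE \<omega> in M. \<omega> \<in> D \<longrightarrow> b u \<omega> \<le> c \<omega>}" "y \<in> {u. AE \<omega> in M. \<omega> \<in> D \<longrightarrow> b u \<omega> \<le> c \<omega>}"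
    and \<xi>: "\<xi> \<in> borel_measurable M" "AE \<omega> in M. 0 \<le> \<xi> \<omega> \<and> \<xi> \<omega> \<le> 1"
  have "AE \<omega> in M. \<omega> \<in> D \<longrightarrow> b (act \<xi> x + act (\<lambda>\<omega>. 1 - \<xi> \<omega>) y) \<omega> \<le> c \<omega>"
    using assms[OF \<xi>, of x y] \<xi>(2) xy[simplified]
  proof eventually_elim
    case (elim \<omega>)
    have "\<xi> \<omega> * b x \<omega> + (1 - \<xi> \<omega>) * b y \<omega> \<le> c \<omega>" if "\<omega> \<in> D"
      using elim that by (intro convex_bound_le) auto
    with elim show ?case by auto
  qed
  then show "act \<xi> x + act (\<lambda>\<omega>. 1 - \<xi> \<omega>) y \<in> {u. AE \<omega> in M. \<omega> \<in> D \<longrightarrow> b u \<omega> \<le> c \<omega>}" by simp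
qed

lemma p_closed_ball:
  assumes "c \<in> borel_measurable M" "D \<in> sets M"
  shows "p_closed {y. AE \<omega> in M. \<omega> \<in> D \<longrightarrow> p (y - u) \<omega> \<le> c \<omega>}"
proof (rule p_closed_sublevel[OF _ _ assms])
  show "AE \<omega> in M. p (x - u) \<omega> \<le> p (y - u) \<omega> + p (y - x) \<omega>" for x y
    using p_triangle_diff[of x u y] p_minus_commute[of x y] by eventually_elim auto
qed measurable

lemma L0_convex_ball: "L0_convex M act {y. AE \<omega> in M. \<omega> \<in> D \<longrightarrow> p (y - u) \<omega> \<le> c \<omega>}"
  by (rule L0_convex_sublevel) (rule p_convex)

section \<open>Homothetic contractions\<close>

text \<open>For \<open>\<kappa> > 0\<close> this is the image of \<open>F\<close> under the
  homothety with centre \<open>s\<close> and ratio \<open>1 / \<kappa>\<close>. Written as a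
  preimage, it inherits closedness and convexity by pulling back.\<close>

definition shrink :: "'e \<Rightarrow> real \<Rightarrow> 'e set \<Rightarrow> 'e set" where
  "shrink s \<kappa> F = {u. s + scal \<kappa> (u - s) \<in> F}"

lemma L0_convex_shrink:
  assumes "L0_convex M act F"
  shows "L0_convex M act (shrink s \<kappa> F)"
proof (rule convexI)
  fix x y and \<xi> :: "'w \<Rightarrow> real"
  assume xy: "x \<in> shrink s \<kappa> F" "y \<in> shrink s \<kappa> F"
    and \<xi>: "\<xi> \<in> borel_measurable M" "AE \<omega> in M. 0 \<le> \<xi> \<omega> \<and> \<xi> \<omega> \<le> 1"
  let ?\<zeta> = "\<lambda>\<omega>. 1 - \<xi> \<omega>"
  have m: "?\<zeta> \<in> borel_measurable M" using \<xi>(1) by simp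
  have "s + scal \<kappa> (act \<xi> x + act ?\<zeta> y - s)
      = act \<xi> (s + scal \<kappa> (x - s)) + act ?\<zeta> (s + scal \<kappa> (y - s))"
  proof -
    have "act \<xi> (s + scal \<kappa> (x - s)) + act ?\<zeta> (s + scal \<kappa> (y - s))
      = (act \<xi> s + act ?\<zeta> s) + scal \<kappa> (act \<xi> x + act ?\<zeta> y - (act \<xi> s + act ?\<zeta> s))"
      by (simp add: act_add_right act_diff_right act_scal \<xi>(1) m scal.scale_right_distrib
          scal.scale_right_diff_distrib algebra_simps)
    then show ?thesis by (simp add: act_complement[OF \<xi>(1)])
  qed
  also have "\<dots> \<in> F"
    using xy by (intro convexD[OF assms _ _ \<xi>]) (auto simp: shrink_def)
  finally show "act \<xi> x + act ?\<zeta> y \<in> shrink s \<kappa> F" by (simp add: shrink_def)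
qed

lemma p_closed_shrink:
  assumes F: "p_closed F" and "0 < \<kappa>"
  shows "p_closed (shrink s \<kappa> F)"
  unfolding p_closed_def
proof (intro allI impI)
  fix u assume u: "\<forall>\<epsilon>>0. \<exists>y\<in>shrink s \<kappa> F. prob {\<omega>\<in>space M. \<epsilon> \<le> p (y - u) \<omega>} < \<epsilon>"
  have "s + scal \<kappa> (u - s) \<in> F"
  proof (rule p_closedD[OF F])
    fix \<epsilon> :: real assume "\<epsilon> > 0"
    \<comment> \<open>The bound \<open>\<epsilon> / \<kappa>\<close> takes care of the distance,
      \<open>\<epsilon>\<close> of the probability.\<close>
    define \<delta> where "\<delta> = min \<epsilon> (\<epsilon> / \<kappa>)"
    have "\<delta> > 0" using \<open>\<epsilon> > 0\<close> \<open>0 < \<kappa>\<close> by (simp add: \<delta>_def)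
    with u obtain y where y: "y \<in> shrink s \<kappa> F" "prob {\<omega>\<in>space M. \<delta> \<le> p (y - u) \<omega>} < \<delta>" by auto
    have eq: "s + scal \<kappa> (y - s) - (s + scal \<kappa> (u - s)) = scal \<kappa> (y - u)"
      by (simp add: scal.scale_right_diff_distrib)
    have "prob {\<omega>\<in>space M. \<epsilon> \<le> p (s + scal \<kappa> (y - s) - (s + scal \<kappa> (u - s))) \<omega>}
        \<le> prob {\<omega>\<in>space M. \<delta> \<le> p (y - u) \<omega>}"
    proof (rule finite_measure_mono_AE)
      show "AE \<omega> in M. \<omega> \<in> {\<omega>\<in>space M. \<epsilon> \<le> p (s + scal \<kappa> (y - s) - (s + scal \<kappa> (u - s))) \<omega>}
          \<longrightarrow> \<omega> \<in> {\<omega>\<in>space M. \<delta> \<le> p (y - u) \<omega>}"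
        unfolding eq using p_scal[of \<kappa> "y - u"]
      proof eventually_elim
        case (elim \<omega>)
        have "\<epsilon> / \<kappa> \<le> p (y - u) \<omega>" if "\<epsilon> \<le> \<kappa> * p (y - u) \<omega>"
          using that \<open>0 < \<kappa>\<close> by (simp add: divide_le_eq mult.commute)
        with elim \<open>0 < \<kappa>\<close> show ?case by (auto simp: \<delta>_def)
      qed
    qed measurable
    also have "\<dots> < \<epsilon>" using y(2) by (simp add: \<delta>_def)
    finally show "\<exists>y\<in>F. prob {\<omega>\<in>space M. \<epsilon> \<le> p (y - (s + scal \<kappa> (u - s))) \<omega>} < \<epsilon>"
      using y(1) by (intro bexI[of _ "s + scal \<kappa> (y - s)"]) (auto simp: shrink_def)
  qed
  then show "u \<in> shrink s \<kappa> F" by (simp add: shrink_def)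
qed

lemma scal_convex:
  assumes "L0_convex M act F" "x \<in> F" "y \<in> F" "0 \<le> t" "t \<le> 1"
  shows "x + scal t (y - x) \<in> F"
proof -
  have "scal t y + scal (1 - t) x \<in> F"
    using convexD[OF assms(1,3,2), of "\<lambda>_. t"] assms(4,5) by (simp add: scal_def)
  then show ?thesis
    by (simp add: scal.scale_left_diff_distrib scal.scale_right_diff_distrib algebra_simps)
qed

text \<open>Passing from \<open>\<kappa>'\<close> to \<open>\<kappa>\<close> moves the dilated point
  along a segment towards \<open>s\<close>, with weight \<open>\<kappa> / \<kappa>'\<close>.
  Together with \<open>shrink_one\<close> this puts contractions with
  \<open>\<kappa> \<ge> 1\<close> inside \<open>F\<close>.\<close>

lemma shrink_antimono:
  assumes F: "L0_convex M act F" "s \<in> F" and "0 < \<kappa>" "\<kappa> \<le> \<kappa>'"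
  shows "shrink s \<kappa>' F \<subseteq> shrink s \<kappa> F"
proof
  fix u assume "u \<in> shrink s \<kappa>' F"
  then have "s + scal \<kappa>' (u - s) \<in> F" by (simp add: shrink_def)
  from scal_convex[OF F this, of "\<kappa> / \<kappa>'"]
  have "s + scal (\<kappa> / \<kappa>') (s + scal \<kappa>' (u - s) - s) \<in> F"
    using assms(3,4) by simp
  then show "u \<in> shrink s \<kappa> F"
    using assms(3,4) by (simp add: shrink_def)
qed

lemma shrink_one: "shrink s 1 F = F"
  by (simp add: shrink_def)

section \<open>Busemann functions of rays\<close>

lemma p_diff_le: "AE \<omega> in M. p (x - y) \<omega> \<le> p x \<omega> + p y \<omega>"
  using p_triangle_diff[of x y 0] p_minus_commute[of 0 y] by eventually_elim simp

text \<open>The Busemann function of the ray \<open>t \<mapsto> x + t v\<close>. Unlike the half-rays themselves, its sublevel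
  sets are easily seen to be closed.\<close>

definition busemann :: "'e \<Rightarrow> 'e \<Rightarrow> 'e \<Rightarrow> 'w \<Rightarrow> real" where
  "busemann x v u \<omega> = lim (\<lambda>t. p (u - x - scal (real t) v) \<omega> - real t * p v \<omega>)"

lemma measurable_busemann [measurable]: "busemann x v u \<in> borel_measurable M"
  unfolding busemann_def by measurable

text \<open>The terms decrease in \<open>t\<close>, since one more step along \<open>v\<close>
  raises the distance by at most \<open>p v\<close>, and the triangle inequality bounds them below.
  So the value of \<open>lim\<close> is a genuine limit almost everywhere.\<close>

lemma busemann_bounds:
  "AE \<omega> in M. (\<lambda>t. p (u - x - scal (real t) v) \<omega> - real t * p v \<omega>) \<longlonglongrightarrow> busemann x v u \<omega>
    \<and> - p (u - x) \<omega> \<le> busemann x v u \<omega>"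
proof -
  let ?a = "\<lambda>t \<omega>. p (u - x - scal (real t) v) \<omega> - real t * p v \<omega>"
  have dec: "AE \<omega> in M. ?a (Suc t) \<omega> \<le> ?a t \<omega>" for t
  proof -
    have "u - x - scal (real (Suc t)) v = u - x - scal (real t) v - v"
      by (simp add: scal.scale_left_distrib algebra_simps)
    then show ?thesis
      using p_diff_le[of "u - x - scal (real t) v" v]
      by (auto elim!: eventually_mono simp: algebra_simps)
  qed
  have low: "AE \<omega> in M. - p (u - x) \<omega> \<le> ?a t \<omega>" for t
    using p_triangle_diff[of "scal (real t) v" 0 "u - x"] p_scal[of "real t" v]
      p_minus_commute[of "u - x" "scal (real t) v"]
    by eventually_elim auto
  have "AE \<omega> in M. (\<forall>t. ?a (Suc t) \<omega> \<le> ?a t \<omega>) \<and> (\<forall>t. - p (u - x) \<omega> \<le> ?a t \<omega>)"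
    using dec low by (simp add: AE_all_countable)
  then show ?thesis
  proof eventually_elim
    case (elim \<omega>)
    then have "decseq (\<lambda>t. ?a t \<omega>)" by (intro decseq_SucI) auto
    with elim obtain L where "(\<lambda>t. ?a t \<omega>) \<longlonglongrightarrow> L"
      by (auto elim: decseq_convergent)
    moreover from this have "busemann x v u \<omega> = L" unfolding busemann_def by (rule limI)
    ultimately show ?case using elim by (auto intro: LIMSEQ_le_const)
  qed
qed

text \<open>Holds for each term and survives the limit, as does convexity below; there are countably
  many \<open>t\<close>, so one null set serves them all. Both properties feed the sublevel set
  lemmas.\<close>

lemma busemann_lipschitz: "AE \<omega> in M. busemann x v u \<omega> \<le> busemann x v u' \<omega> + p (u' - u) \<omega>"
proof -
  have "AE \<omega> in M. p (u - x - scal (real t) v) \<omega>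
      \<le> p (u' - x - scal (real t) v) \<omega> + p (u' - u) \<omega>" for t
    using p_le_diff[of "u - x - scal (real t) v" "u' - x - scal (real t) v"] p_minus_commute[of u u']
    by (auto elim!: eventually_elim2 simp: algebra_simps)
  then have "AE \<omega> in M. \<forall>t. p (u - x - scal (real t) v) \<omega>
      \<le> p (u' - x - scal (real t) v) \<omega> + p (u' - u) \<omega>"
    by (subst AE_all_countable) auto
  with busemann_bounds[of u x v] busemann_bounds[of u' x v] show ?thesis
  proof eventually_elim
    case (elim \<omega>)
    have "(\<lambda>t. p (u' - x - scal (real t) v) \<omega> - real t * p v \<omega> + p (u' - u) \<omega>)
        \<longlonglongrightarrow> busemann x v u' \<omega> + p (u' - u) \<omega>"
      using elim by (intro tendsto_intros) auto
    then show ?case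
      using elim by (intro LIMSEQ_le[where X = "\<lambda>t. p (u - x - scal (real t) v) \<omega> - real t * p v \<omega>"]) auto
  qed
qed

lemma busemann_convex:
  assumes \<xi>: "\<xi> \<in> borel_measurable M" "AE \<omega> in M. 0 \<le> \<xi> \<omega> \<and> \<xi> \<omega> \<le> 1"
  shows "AE \<omega> in M. busemann x v (act \<xi> y + act (\<lambda>\<omega>. 1 - \<xi> \<omega>) z) \<omega>
    \<le> \<xi> \<omega> * busemann x v y \<omega> + (1 - \<xi> \<omega>) * busemann x v z \<omega>"
proof -
  let ?w = "act \<xi> y + act (\<lambda>\<omega>. 1 - \<xi> \<omega>) z"
  have "AE \<omega> in M. p (?w - x - scal (real t) v) \<omega>
      \<le> \<xi> \<omega> * p (y - x - scal (real t) v) \<omega> + (1 - \<xi> \<omega>) * p (z - x - scal (real t) v) \<omega>" for t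
    using p_convex[OF \<xi>, of y z "x + scal (real t) v"] by (simp only: diff_diff_eq)
  then have "AE \<omega> in M. \<forall>t. p (?w - x - scal (real t) v) \<omega>
      \<le> \<xi> \<omega> * p (y - x - scal (real t) v) \<omega> + (1 - \<xi> \<omega>) * p (z - x - scal (real t) v) \<omega>"
    by (subst AE_all_countable) auto
  with busemann_bounds[of ?w x v] busemann_bounds[of y x v] busemann_bounds[of z x v]
  show ?thesis
  proof eventually_elim
    case (elim \<omega>)
    have "(\<lambda>t. \<xi> \<omega> * (p (y - x - scal (real t) v) \<omega> - real t * p v \<omega>)
        + (1 - \<xi> \<omega>) * (p (z - x - scal (real t) v) \<omega> - real t * p v \<omega>))
      \<longlonglongrightarrow> \<xi> \<omega> * busemann x v y \<omega> + (1 - \<xi> \<omega>) * busemann x v z \<omega>"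
      using elim by (intro tendsto_intros) auto
    then show ?case
      using elim by (intro LIMSEQ_le[where X = "\<lambda>t. p (?w - x - scal (real t) v) \<omega> - real t * p v \<omega>"])
        (auto simp: algebra_simps)
  qed
qed

text \<open>Once \<open>t \<ge> s\<close> the terms are constant, namely
  \<open>(t - s) * p v - t * p v\<close>: the function falls linearly along its own ray.\<close>

lemma busemann_ray:
  "AE \<omega> in M. busemann x v (x + scal s v) \<omega> = - s * p v \<omega>"
proof -
  have "AE \<omega> in M. p (x + scal s v - x - scal (real t) v) \<omega> = \<bar>s - real t\<bar> * p v \<omega>" for t
    using p_scal[of "s - real t" v] by (simp add: scal.scale_left_diff_distrib)
  then have "AE \<omega> in M. \<forall>t. p (x + scal s v - x - scal (real t) v) \<omega> = \<bar>s - real t\<bar> * p v \<omega>"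
    by (subst AE_all_countable) auto
  with busemann_bounds[of "x + scal s v" x v] show ?thesis
  proof eventually_elim
    case (elim \<omega>)
    have "eventually (\<lambda>t. - s * p v \<omega>
        = p (x + scal s v - x - scal (real t) v) \<omega> - real t * p v \<omega>) sequentially"
      using eventually_ge_at_top[of "nat \<lceil>s\<rceil>"]
    proof eventually_elim
      case (elim t)
      then have "s \<le> real t" by linarith
      with \<open>\<forall>t. p (x + scal s v - x - scal (real t) v) \<omega> = \<bar>s - real t\<bar> * p v \<omega>\<close>
      show ?case by (simp add: algebra_simps)
    qed
    then have "(\<lambda>t. p (x + scal s v - x - scal (real t) v) \<omega> - real t * p v \<omega>) \<longlonglongrightarrow> - s * p v \<omega>"
      by (rule tendsto_eventually[OF eventually_mono]) simp
    with elim show ?case by (auto intro: LIMSEQ_unique)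
  qed
qed

section \<open>Sequential convex compactness, rays and saturation\<close>

text \<open>The \<open>C n\<close> are closed and convex in the whole module and merely meet
  \<open>S\<close>; their traces on \<open>S\<close> are relatively closed, and the same
  \<open>C n\<close> can be tested against the saturation.\<close>

definition convexly_seq_compact :: "'e set \<Rightarrow> bool" where
  "convexly_seq_compact S \<longleftrightarrow>
    (\<forall>C::nat \<Rightarrow> 'e set. decseq C \<and>
      (\<forall>n. L0_convex M act (C n) \<and> p_closed (C n) \<and> C n \<inter> S \<noteq> {}) \<longrightarrow> (\<exists>u\<in>S. \<forall>n. u \<in> C n))"

lemma convexly_seq_compactD:
  fixes C :: "nat \<Rightarrow> 'e set"
  assumes "convexly_seq_compact S" "decseq C" "\<And>n. L0_convex M act (C n)" "\<And>n. p_closed (C n)"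
    and "\<And>n. C n \<inter> S \<noteq> {}"
  obtains u where "u \<in> S" "\<And>n. u \<in> C n"
  using assms unfolding convexly_seq_compact_def by blast

text \<open>The sublevel sets at \<open>- n * p v\<close> all meet the ray. A common point
  \<open>u\<close> has a Busemann value below all these levels, yet at least
  \<open>- p (u - x)\<close>; this forces \<open>p v = 0\<close>.\<close>

lemma ray_trivial:
  assumes S: "convexly_seq_compact S" and ray: "\<And>k. x + scal (2^k) v \<in> S"
  shows "AE \<omega> in M. p v \<omega> = 0"
proof -
  \<comment> \<open>The level is itself random, so that it scales with \<open>p v\<close> at each
    sample point. The premise \<open>\<omega> \<in> space M\<close> fits the set to the form of the
    sublevel set lemmas.\<close>
  define C where "C n = {u. AE \<omega> in M. \<omega> \<in> space M \<longrightarrow> busemann x v u \<omega> \<le> - real n * p v \<omega>}" for n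
  have dec: "decseq C"
  proof (rule decseq_SucI)
    fix n show "C (Suc n) \<subseteq> C n"
    proof
      fix u assume "u \<in> C (Suc n)"
      then have "AE \<omega> in M. \<omega> \<in> space M \<longrightarrow> busemann x v u \<omega> \<le> - real (Suc n) * p v \<omega>"
        by (simp add: C_def)
      with p_nonneg[of v] have "AE \<omega> in M. \<omega> \<in> space M \<longrightarrow> busemann x v u \<omega> \<le> - real n * p v \<omega>"
        by eventually_elim (auto simp: algebra_simps)
      then show "u \<in> C n" by (simp add: C_def)
    qed
  qed
  have conv: "L0_convex M act (C n)" for n
    unfolding C_def by (intro L0_convex_sublevel busemann_convex)
  have clo: "p_closed (C n)" for n
    unfolding C_def by (intro p_closed_sublevel busemann_lipschitz) measurable
  have ne: "C n \<inter> S \<noteq> {}" for n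
  proof -
    \<comment> \<open>The ray is known to lie in \<open>S\<close> only at powers of 2; the
      \<open>n\<close>-th of them has parameter at least \<open>n\<close>.\<close>
    have "real n \<le> 2^n" using of_nat_less_two_power[of n, where ?'a = real] by simp
    have "AE \<omega> in M. \<omega> \<in> space M \<longrightarrow> busemann x v (x + scal (2^n) v) \<omega> \<le> - real n * p v \<omega>"
      using busemann_ray[of x v "2^n"] p_nonneg[of v]
      by eventually_elim (use \<open>real n \<le> 2^n\<close> in \<open>auto intro: mult_right_mono\<close>)
    then have "x + scal (2^n) v \<in> C n \<inter> S"
      using ray by (auto simp: C_def)
    then show ?thesis by blast
  qed
  obtain u where "\<And>n. u \<in> C n"
    using convexly_seq_compactD[OF S dec conv clo ne] by blast
  then have "AE \<omega> in M. \<forall>n. \<omega> \<in> space M \<longrightarrow> busemann x v u \<omega> \<le> - real n * p v \<omega>"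
    by (subst AE_all_countable) (simp add: C_def)
  with busemann_bounds[of u x v] p_nonneg[of v] AE_space show ?thesis
  proof eventually_elim
    case (elim \<omega>)
    then have le: "real n * p v \<omega> \<le> p (u - x) \<omega>" for n
      by (auto dest!: spec[of _ n])
    show ?case
    proof (rule ccontr)
      assume "p v \<omega> \<noteq> 0"
      with elim have "0 < p v \<omega>" by simp
      then obtain n where "p (u - x) \<omega> < real n * p v \<omega>" using reals_Archimedean3 by blast
      with le[of n] show False by simp
    qed
  qed
qed

text \<open>Being complete only up to null elements of \<open>p\<close>, a compact \<open>G\<close> need not be \<open>p\<close>-closed; its
  saturation is.\<close>

definition saturation :: "'e set \<Rightarrow> 'e set" where
  "saturation G = {u. \<exists>g\<in>G. AE \<omega> in M. p (g - u) \<omega> = 0}"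

lemma subset_saturation: "G \<subseteq> saturation G"
proof
  fix g assume "g \<in> G"
  then show "g \<in> saturation G"
    unfolding saturation_def using p_zero by (intro CollectI bexI[of _ g]) simp_all
qed

lemma L0_convex_saturation:
  assumes "L0_convex M act G"
  shows "L0_convex M act (saturation G)"
proof (rule convexI)
  fix x y and \<xi> :: "'w \<Rightarrow> real"
  assume xy: "x \<in> saturation G" "y \<in> saturation G"
    and \<xi>: "\<xi> \<in> borel_measurable M" "AE \<omega> in M. 0 \<le> \<xi> \<omega> \<and> \<xi> \<omega> \<le> 1"
  let ?\<zeta> = "\<lambda>\<omega>. 1 - \<xi> \<omega>"
  have m: "?\<zeta> \<in> borel_measurable M" using \<xi>(1) by simp
  obtain g h where g: "g \<in> G" "AE \<omega> in M. p (g - x) \<omega> = 0" and h: "h \<in> G" "AE \<omega> in M. p (h - y) \<omega> = 0"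
    using xy by (auto simp: saturation_def)
  have eq: "act \<xi> g + act ?\<zeta> h - (act \<xi> x + act ?\<zeta> y) = act \<xi> (g - x) + act ?\<zeta> (h - y)"
    by (simp add: act_diff_right \<xi>(1) m)
  have "AE \<omega> in M. p (act \<xi> g + act ?\<zeta> h - (act \<xi> x + act ?\<zeta> y)) \<omega> = 0"
    unfolding eq
    using p_triangle[of "act \<xi> (g - x)" "act ?\<zeta> (h - y)"] p_act[OF \<xi>(1), of "g - x"]
      p_act[OF m, of "h - y"] g(2) h(2) p_nonneg[of "act \<xi> (g - x) + act ?\<zeta> (h - y)"]
    by eventually_elim simp
  moreover have "act \<xi> g + act ?\<zeta> h \<in> G" by (intro convexD[OF assms g(1) h(1) \<xi>])
  ultimately show "act \<xi> x + act ?\<zeta> y \<in> saturation G" by (auto simp: saturation_def)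
qed

text \<open>A \<open>p_closed\<close> set contains, with each point, all points at
  \<open>p\<close>-distance zero; if it meets the saturation, it meets \<open>G\<close>.\<close>

lemma convexly_seq_compact_saturation:
  assumes "convexly_seq_compact G"
  shows "convexly_seq_compact (saturation G)"
  unfolding convexly_seq_compact_def
proof (intro allI impI, elim conjE)
  fix C :: "nat \<Rightarrow> 'e set"
  assume dec: "decseq C" and C: "\<forall>n. L0_convex M act (C n) \<and> p_closed (C n) \<and> C n \<inter> saturation G \<noteq> {}"
  have "C n \<inter> G \<noteq> {}" for n
  proof -
    obtain u g where u: "u \<in> C n" "g \<in> G" "AE \<omega> in M. p (g - u) \<omega> = 0"
      using C by (force simp: saturation_def)
    have "AE \<omega> in M. p (u - g) \<omega> = 0"
      using u(3) p_minus_commute[of g u] by eventually_elim simp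
    with u C have "g \<in> C n" by (auto intro: p_closed_null)
    with u show ?thesis by auto
  qed
  then obtain u where "u \<in> G" "\<And>n. u \<in> C n"
    using convexly_seq_compactD[OF assms dec] C by blast
  then show "\<exists>u\<in>saturation G. \<forall>n. u \<in> C n" using subset_saturation by blast
qed

text \<open>Approximants of \<open>u\<close> in \<open>G\<close> within \<open>2^-k\<close>, up to
  probability \<open>2^-k\<close>, converge almost surely by Borel-Cantelli. Balls around
  \<open>u\<close> of radius \<open>2^-k\<close>, imposed on the event \<open>B k\<close>, then meet
  \<open>G\<close>, and a common point in \<open>G\<close> is at \<open>p\<close>-distance zero from
  \<open>u\<close>.\<close>

lemma p_closed_saturation:
  assumes "convexly_seq_compact G"
  shows "p_closed (saturation G)"
  unfolding p_closed_def
proof (intro allI impI)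
  fix u assume u: "\<forall>\<epsilon>>0. \<exists>y\<in>saturation G. prob {\<omega>\<in>space M. \<epsilon> \<le> p (y - u) \<omega>} < \<epsilon>"
  have "\<exists>g\<in>G. prob {\<omega>\<in>space M. \<epsilon> \<le> p (g - u) \<omega>} < \<epsilon>" if "\<epsilon> > 0" for \<epsilon>
  proof -
    obtain y g where y: "prob {\<omega>\<in>space M. \<epsilon> \<le> p (y - u) \<omega>} < \<epsilon>" "g \<in> G" "AE \<omega> in M. p (g - y) \<omega> = 0"
      using u \<open>\<epsilon> > 0\<close> by (auto simp: saturation_def)
    have "prob {\<omega>\<in>space M. \<epsilon> \<le> p (g - u) \<omega>} \<le> prob {\<omega>\<in>space M. \<epsilon> \<le> p (y - u) \<omega>}"
    proof (rule finite_measure_mono_AE)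
      show "AE \<omega> in M. \<omega> \<in> {\<omega>\<in>space M. \<epsilon> \<le> p (g - u) \<omega>} \<longrightarrow> \<omega> \<in> {\<omega>\<in>space M. \<epsilon> \<le> p (y - u) \<omega>}"
        using y(3) p_triangle_diff[of g u y] by eventually_elim auto
    qed measurable
    with y show ?thesis by (intro bexI[of _ g]) auto
  qed
  then have "\<exists>g\<in>G. prob {\<omega>\<in>space M. (1/2)^k \<le> p (g - u) \<omega>} < (1/2)^k" for k :: nat
    by simp
  then obtain y where y: "\<And>k. y k \<in> G" "\<And>k. prob {\<omega>\<in>space M. (1/2)^k \<le> p (y k - u) \<omega>} < (1/2)^k"
    by metis
  let ?A = "\<lambda>k. {\<omega>\<in>space M. (1/2)^k \<le> p (y k - u) \<omega>}"
  define B where "B m = {\<omega>\<in>space M. \<forall>k\<ge>m. p (y k - u) \<omega> < (1/2)^k}" for m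
  have [measurable]: "B m \<in> sets M" for m unfolding B_def by measurable
  have "summable (\<lambda>k. prob (?A k))"
    by (rule summable_comparison_test[OF _ summable_geometric[of "1/2"]])
      (use y(2) in \<open>auto intro!: exI[of _ 0] less_imp_le\<close>)
  then have "AE \<omega> in M. eventually (\<lambda>k. \<omega> \<in> space M - ?A k) sequentially"
    by (intro borel_cantelli_AE1) (auto simp: emeasure_eq_measure)
  then have ev: "AE \<omega> in M. \<exists>m. \<omega> \<in> B m"
    by eventually_elim (auto simp: B_def eventually_sequentially not_le)
  define C where "C k = {z. AE \<omega> in M. \<omega> \<in> B k \<longrightarrow> p (z - u) \<omega> \<le> (1/2)^k}" for k
  have dec: "decseq C"
  proof (rule decseq_SucI)
    fix k
    \<comment> \<open>As \<open>k\<close> grows, the radius falls and the event grows, so the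
      constraint tightens.\<close>
    have sub: "B k \<subseteq> B (Suc k)" by (auto simp: B_def)
    show "C (Suc k) \<subseteq> C k"
    proof
      fix z assume "z \<in> C (Suc k)"
      then have "AE \<omega> in M. \<omega> \<in> B (Suc k) \<longrightarrow> p (z - u) \<omega> \<le> (1/2)^Suc k"
        by (simp add: C_def)
      then have "AE \<omega> in M. \<omega> \<in> B k \<longrightarrow> p (z - u) \<omega> \<le> (1/2)^k"
      proof eventually_elim
        case (elim \<omega>)
        moreover have "(1/2::real)^Suc k \<le> (1/2)^k" by simp
        ultimately show ?case using sub by (meson order_trans subsetD)
      qed
      then show "z \<in> C k" by (simp add: C_def)
    qed
  qed
  have conv: "L0_convex M act (C k)" for k unfolding C_def by (rule L0_convex_ball)
  have clo: "p_closed (C k)" for k unfolding C_def by (rule p_closed_ball) measurable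
  have "y k \<in> C k" for k by (auto simp: C_def B_def intro!: AE_I2 less_imp_le)
  with y(1) have ne: "C k \<inter> G \<noteq> {}" for k by blast
  obtain g where g: "g \<in> G" "\<And>k. g \<in> C k"
    using convexly_seq_compactD[OF assms dec conv clo ne] by blast
  have "AE \<omega> in M. \<forall>k. \<omega> \<in> B k \<longrightarrow> p (g - u) \<omega> \<le> (1/2)^k"
    using g(2) by (subst AE_all_countable) (simp add: C_def)
  with ev p_nonneg[of "g - u"] have "AE \<omega> in M. p (g - u) \<omega> = 0"
  proof eventually_elim
    case (elim \<omega>)
    then obtain m where "\<omega> \<in> B m" by auto
    then have "\<omega> \<in> B k" if "k \<ge> m" for k using that by (auto simp: B_def)
    with elim have "\<forall>k\<ge>m. p (g - u) \<omega> \<le> (1/2)^k" by auto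
    moreover have "(\<lambda>k. (1/2::real)^k) \<longlonglongrightarrow> 0" by (rule LIMSEQ_power_zero) simp
    ultimately have "p (g - u) \<omega> \<le> 0" by (intro LIMSEQ_le_const) auto
    with elim show ?case by simp
  qed
  with g(1) show "u \<in> saturation G" by (auto simp: saturation_def)
qed

section \<open>Unboundedness in probability\<close>

lemma p_tail:
  assumes "\<epsilon> > 0"
  shows "\<exists>n\<ge>k. prob {\<omega>\<in>space M. real n < p x \<omega>} < \<epsilon>"
proof -
  have "(\<lambda>n. prob {\<omega>\<in>space M. real n < p x \<omega>}) \<longlonglongrightarrow> prob (\<Inter>n. {\<omega>\<in>space M. real n < p x \<omega>})"
    by (intro finite_Lim_measure_decseq) (auto simp: decseq_def)
  also have "(\<Inter>n. {\<omega>\<in>space M. real n < p x \<omega>}) = {}"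
    by (auto simp: not_less) (meson reals_Archimedean2 less_asym)
  finally have "eventually (\<lambda>n. prob {\<omega>\<in>space M. real n < p x \<omega>} < \<epsilon>) sequentially"
    using assms by (intro order_tendstoD) auto
  then show ?thesis
    unfolding eventually_sequentially by (meson linorder_linear)
qed

text \<open>At every level \<open>N\<close> the supremum of the probabilities over \<open>F\<close>
  is at least \<open>\<theta>\<close>. The slack \<open>\<epsilon>\<close> lets
  \<open>\<theta>\<close> survive contractions undiminished.\<close>

definition unbounded_in_prob :: "real \<Rightarrow> 'e set \<Rightarrow> bool" where
  "unbounded_in_prob \<theta> F \<longleftrightarrow>
    (\<forall>N. \<forall>\<epsilon>>0. \<exists>s\<in>F. \<theta> - \<epsilon> < prob {\<omega>\<in>space M. N < p s \<omega>})"

text \<open>A point \<open>y\<close> of \<open>F\<close> is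
  \<open>\<kappa> u + (1 - \<kappa>) s\<close> with \<open>u\<close> in the contraction. If
  \<open>p y\<close> is very large, then so is \<open>p u\<close>, except where \<open>p s\<close>
  exceeds \<open>n\<close>, which has probability below \<open>\<epsilon> / 2\<close>.\<close>

lemma unbounded_in_prob_shrink:
  assumes F: "unbounded_in_prob \<theta> F" and "0 < \<kappa>"
  shows "unbounded_in_prob \<theta> (shrink s \<kappa> F)"
  unfolding unbounded_in_prob_def
proof (intro allI impI)
  fix N \<epsilon> :: real assume "\<epsilon> > 0"
  obtain n where n: "prob {\<omega>\<in>space M. real n < p s \<omega>} < \<epsilon> / 2"
    using p_tail[of "\<epsilon> / 2"] \<open>\<epsilon> > 0\<close> by auto
  obtain y where y: "y \<in> F"
    "\<theta> - \<epsilon> / 2 < prob {\<omega>\<in>space M. \<kappa> * N + \<bar>1 - \<kappa>\<bar> * real n < p y \<omega>}"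
    using F \<open>\<epsilon> > 0\<close> unfolding unbounded_in_prob_def by (meson half_gt_zero)
  define u where "u = s + scal (1 / \<kappa>) (y - s)"
  have "u \<in> shrink s \<kappa> F" using y(1) \<open>0 < \<kappa>\<close> by (simp add: u_def shrink_def)
  have eq: "y = scal \<kappa> u + scal (1 - \<kappa>) s"
    using \<open>0 < \<kappa>\<close> by (simp add: u_def scal.scale_right_distrib scal.scale_left_diff_distrib)
  have py: "AE \<omega> in M. p y \<omega> \<le> \<kappa> * p u \<omega> + \<bar>1 - \<kappa>\<bar> * p s \<omega>"
    unfolding eq
    using p_triangle[of "scal \<kappa> u" "scal (1 - \<kappa>) s"] p_scal[of \<kappa> u] p_scal[of "1 - \<kappa>" s]
    by eventually_elim (use \<open>0 < \<kappa>\<close> in simp)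
  have "prob {\<omega>\<in>space M. \<kappa> * N + \<bar>1 - \<kappa>\<bar> * real n < p y \<omega>}
      \<le> prob ({\<omega>\<in>space M. N < p u \<omega>} \<union> {\<omega>\<in>space M. real n < p s \<omega>})"
  proof (rule finite_measure_mono_AE)
    show "AE \<omega> in M. \<omega> \<in> {\<omega>\<in>space M. \<kappa> * N + \<bar>1 - \<kappa>\<bar> * real n < p y \<omega>} \<longrightarrow>
        \<omega> \<in> {\<omega>\<in>space M. N < p u \<omega>} \<union> {\<omega>\<in>space M. real n < p s \<omega>}"
      using py
    proof eventually_elim
      case (elim \<omega>)
      have "p y \<omega> \<le> \<kappa> * N + \<bar>1 - \<kappa>\<bar> * real n" if "p u \<omega> \<le> N" "p s \<omega> \<le> real n"
        using elim mult_left_mono[OF that(1), of \<kappa>] mult_left_mono[OF that(2), of "\<bar>1 - \<kappa>\<bar>"] \<open>0 < \<kappa>\<close>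
        by linarith
      then show ?case by force
    qed
  qed measurable
  also have "\<dots> \<le> prob {\<omega>\<in>space M. N < p u \<omega>} + prob {\<omega>\<in>space M. real n < p s \<omega>}"
    by (intro measure_Un_le) measurable
  finally have "\<theta> - \<epsilon> < prob {\<omega>\<in>space M. N < p u \<omega>}" using n y(2) by simp
  with \<open>u \<in> shrink s \<kappa> F\<close> show "\<exists>u\<in>shrink s \<kappa> F. \<theta> - \<epsilon> < prob {\<omega>\<in>space M. N < p u \<omega>}" by blast
qed

text \<open>If \<open>p\<close> were small at points of all the sets \<open>shrink s (2^k) F\<close>, then, by compactness, also at a
  point \<open>w\<close> common to all of them; but the ray from \<open>s\<close> through \<open>w\<close> lies in \<open>S\<close>.\<close>

lemma shrink_away:
  assumes S: "convexly_seq_compact S"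
    and F: "L0_convex M act F" "p_closed F" "F \<subseteq> S" "unbounded_in_prob \<theta> F" and "\<theta> > 0"
  obtains s k where "s \<in> F" "\<And>z. z \<in> shrink s (2^k) F \<Longrightarrow> \<theta> / 2 \<le> prob {\<omega>\<in>space M. N < p z \<omega>}"
proof -
  obtain s where s: "s \<in> F" "\<theta> - \<theta> / 4 < prob {\<omega>\<in>space M. N < p s \<omega>}"
    using F(4) \<open>\<theta> > 0\<close> unfolding unbounded_in_prob_def by (meson zero_less_divide_iff zero_less_numeral)
  have "\<exists>k. \<forall>z\<in>shrink s (2^k) F. \<theta> / 2 \<le> prob {\<omega>\<in>space M. N < p z \<omega>}"
  proof (rule ccontr)
    assume "\<not> ?thesis"
    then have "\<forall>k. \<exists>z. z \<in> shrink s (2^k) F \<and> prob {\<omega>\<in>space M. N < p z \<omega>} < \<theta> / 2"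
      by (auto simp: not_le Bex_def)
    from choice[OF this] obtain z where z: "\<And>k. z k \<in> shrink s (2^k) F"
      "\<And>k. prob {\<omega>\<in>space M. N < p (z k) \<omega>} < \<theta> / 2"
      by blast
    define H where "H k = shrink s (2^k) F" for k :: nat
    have dec: "decseq H"
      unfolding H_def by (intro decseq_SucI shrink_antimono F(1) s(1)) auto
    have sub: "H k \<subseteq> F" for k
      using shrink_antimono[OF F(1) s(1), of 1 "2^k"] by (simp add: H_def shrink_one)
    have conv: "L0_convex M act (H k)" for k
      unfolding H_def by (rule L0_convex_shrink[OF F(1)])
    have large: "1 - \<theta> / 2 \<le> prob {\<omega>\<in>space M. p (z k) \<omega> \<le> N}" for k
    proof -
      have "prob {\<omega>\<in>space M. \<not> N < p (z k) \<omega>} = 1 - prob {\<omega>\<in>space M. N < p (z k) \<omega>}"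
        by (intro prob_neg) measurable
      with z(2)[of k] show ?thesis by (simp add: not_less)
    qed
    \<comment> \<open>The bounds on \<open>p (z k)\<close> hold on events varying with
      \<open>k\<close>; the single \<open>B\<close> makes the sets \<open>C k\<close> below
      decrease. Its complement has probability at most 3/4 of \<open>\<theta>\<close>, which
      \<open>s\<close> was chosen to beat strictly.\<close>
    obtain B where B: "B \<in> sets M" "1 - \<theta> / 2 - \<theta> / 4 \<le> prob B"
      "\<And>k. \<exists>y\<in>H k. AE \<omega> in M. \<omega> \<in> B \<longrightarrow> p (y - 0) \<omega> \<le> N"
    proof (rule common_event[OF dec conv _ large, where z = z and R = "\<lambda>_ r. r \<le> N" and u = 0
          and \<eta>' = "1 - \<theta> / 2 - \<theta> / 4"])
      show "{\<omega>\<in>space M. p (z k) \<omega> \<le> N} \<in> sets M" for k by measurable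
    qed (use z(1) \<open>\<theta> > 0\<close> in \<open>auto simp: H_def\<close>)
    define C where "C k = H k \<inter> {y. AE \<omega> in M. \<omega> \<in> B \<longrightarrow> p (y - 0) \<omega> \<le> N}" for k
    obtain w where w: "\<And>k. w \<in> C k"
    proof (rule convexly_seq_compactD[OF S, of C])
      show "decseq C" using dec by (auto simp: C_def decseq_def)
      show "L0_convex M act (C k)" for k
        unfolding C_def by (intro L0_convex_Int conv L0_convex_ball)
      show "p_closed (C k)" for k
        unfolding C_def H_def by (intro p_closed_Int p_closed_shrink F(2) p_closed_ball B(1)) auto
      show "C k \<inter> S \<noteq> {}" for k
        using B(3)[of k] sub[of k] F(3) by (auto simp: C_def)
    qed blast
    \<comment> \<open>Membership of \<open>w\<close> in every \<open>H k\<close> says that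
      \<open>s + 2^k (w - s)\<close> lies in \<open>F\<close>, hence in \<open>S\<close>.\<close>
    have "AE \<omega> in M. p (w - s) \<omega> = 0"
      using w F(3) by (intro ray_trivial[OF S, of s]) (auto simp: C_def H_def shrink_def)
    moreover have "AE \<omega> in M. \<omega> \<in> B \<longrightarrow> p w \<omega> \<le> N" using w[of 0] by (simp add: C_def)
    ultimately have "AE \<omega> in M. \<omega> \<in> B \<longrightarrow> p s \<omega> \<le> N"
      using p_le_diff[of s w] p_minus_commute[of s w] by eventually_elim auto
    then have "AE \<omega> in M. \<omega> \<in> {\<omega>\<in>space M. N < p s \<omega>} \<longrightarrow> \<omega> \<in> space M - B"
      by (auto elim!: eventually_mono)
    then have "prob {\<omega>\<in>space M. N < p s \<omega>} \<le> prob (space M - B)"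
      by (rule finite_measure_mono_AE) (use B(1) in auto)
    with s(2) B(1,2) show False by (simp add: prob_compl)
  qed
  with s(1) that show thesis by blast
qed

text \<open>Iterated contraction yields nested sets whose common point \<open>z\<close> satisfies
  \<open>p z > n\<close> with probability at least \<open>\<theta> / 2\<close> for all
  \<open>n \<ge> 1\<close>, although \<open>p z\<close> is finite.\<close>

lemma not_unbounded_in_prob:
  assumes S: "convexly_seq_compact S" "L0_convex M act S" "p_closed S" and "\<theta> > 0"
  shows "\<not> unbounded_in_prob \<theta> S"
proof
  assume unb: "unbounded_in_prob \<theta> S"
  define P where "P n F \<longleftrightarrow> L0_convex M act F \<and> p_closed F \<and> F \<subseteq> S \<and> unbounded_in_prob \<theta> F \<and>
    (n > 0 \<longrightarrow> (\<forall>z\<in>F. \<theta> / 2 \<le> prob {\<omega>\<in>space M. real n < p z \<omega>}))" for n F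
  have "\<exists>f. \<forall>n. P n (f n) \<and> f (Suc n) \<subseteq> f n"
  proof (rule dependent_nat_choice)
    show "\<exists>F. P 0 F" using S unb by (auto simp: P_def)
  next
    fix F n assume "P n F"
    then have F: "L0_convex M act F" "p_closed F" "F \<subseteq> S" "unbounded_in_prob \<theta> F"
      by (auto simp: P_def)
    obtain s k where sk: "s \<in> F"
      "\<And>z. z \<in> shrink s (2^k) F \<Longrightarrow> \<theta> / 2 \<le> prob {\<omega>\<in>space M. real (Suc n) < p z \<omega>}"
      using shrink_away[OF S(1) F \<open>\<theta> > 0\<close>] by blast
    have sub: "shrink s (2^k) F \<subseteq> F"
      using shrink_antimono[OF F(1) sk(1), of 1 "2^k"] by (simp add: shrink_one)
    have "P (Suc n) (shrink s (2^k) F)"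
      unfolding P_def using sub F sk(2)
      by (auto intro: L0_convex_shrink p_closed_shrink unbounded_in_prob_shrink)
    with sub show "\<exists>F'. P (Suc n) F' \<and> F' \<subseteq> F" by blast
  qed
  then obtain f where f: "\<And>n. P n (f n)" "\<And>n. f (Suc n) \<subseteq> f n" by blast
  have ne: "f n \<inter> S \<noteq> {}" for n
  proof -
    obtain z where "z \<in> f n"
      using f(1)[of n] unfolding P_def unbounded_in_prob_def by (meson zero_less_one)
    with f(1)[of n] show ?thesis by (auto simp: P_def)
  qed
  obtain z where z: "\<And>n. z \<in> f n"
  proof (rule convexly_seq_compactD[OF S(1) _ _ _ ne])
    show "decseq f" using f(2) by (rule decseq_SucI)
  qed (use f(1) in \<open>auto simp: P_def\<close>)
  obtain n where "n \<ge> 1" "prob {\<omega>\<in>space M. real n < p z \<omega>} < \<theta> / 2"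
    using p_tail[of "\<theta> / 2" 1] \<open>\<theta> > 0\<close> by auto
  with f(1)[of n] z[of n] show False by (auto simp: P_def)
qed

section \<open>From boundedness in probability to almost sure boundedness\<close>

text \<open>The bound is the essential supremum, realised as a countable supremum \<open>X\<close>
  over elements that nearly maximise the probability of exceeding a rational level. Gluing gives
  both its finiteness and its domination of all \<open>p g\<close>.\<close>

lemma AE_bounded_if_bounded_in_prob:
  assumes G: "L0_convex M act G" "G \<noteq> {}"
    and bdd: "\<And>\<theta>. \<theta> > 0 \<Longrightarrow> \<exists>N. \<forall>g\<in>G. prob {\<omega>\<in>space M. N < p g \<omega>} < \<theta>"
  shows "\<exists>\<xi>\<in>borel_measurable M. \<forall>g\<in>G. AE \<omega> in M. p g \<omega> \<le> \<xi> \<omega>"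
proof -
  define c where "c r = (SUP g\<in>G. prob {\<omega>\<in>space M. r < p g \<omega>})" for r
  have bdd_c: "bdd_above ((\<lambda>g. prob {\<omega>\<in>space M. r < p g \<omega>}) ` G)" for r
    by (intro bdd_aboveI[of _ 1]) auto
  have "\<exists>g\<in>G. c r - 1 / real (Suc j) < prob {\<omega>\<in>space M. r < p g \<omega>}" for r j
    using less_cSUP_iff[OF G(2) bdd_c, of "c r - 1 / real (Suc j)" r] by (simp add: c_def)
  then obtain g where g: "\<And>r j. g r j \<in> G"
    "\<And>r j. c r - 1 / real (Suc j) < prob {\<omega>\<in>space M. r < p (g r j) \<omega>}"
    by metis
  define h where "h n = (case from_nat n of (r::rat, j::nat) \<Rightarrow> g (of_rat r) j)" for n
  have hG: "h n \<in> G" for n using g(1) by (simp add: h_def split: prod.split)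
  have gh: "\<exists>n. g (of_rat r) j = h n" for r j
    by (intro exI[of _ "to_nat (r, j)"]) (simp add: h_def)
  define X where "X \<omega> = (SUP n. ereal (p (h n) \<omega>))" for \<omega>
  have [measurable]: "X \<in> borel_measurable M" unfolding X_def by measurable
  have X_finite: "AE \<omega> in M. X \<omega> \<noteq> \<infinity>"
  proof -
    have "prob {\<omega>\<in>space M. X \<omega> = \<infinity>} \<le> \<theta>" if "\<theta> > 0" for \<theta>
    proof -
      obtain N where N: "\<And>g. g \<in> G \<Longrightarrow> prob {\<omega>\<in>space M. N < p g \<omega>} < \<theta>"
        using bdd[OF \<open>\<theta> > 0\<close>] by blast
      let ?D = "\<lambda>i. {\<omega>\<in>space M. N < p (h i) \<omega>}"
      have "prob (\<Union>i\<in>{..m}. ?D i) \<le> \<theta>" for m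
      proof -
        \<comment> \<open>One glued element exceeds \<open>N\<close> wherever any of
          \<open>h 0\<close>, ..., \<open>h m\<close> does, so the bound \<open>\<theta>\<close> is
          uniform in \<open>m\<close>.\<close>
        have "\<exists>y\<in>G. AE \<omega> in M. \<omega> \<in> (\<Union>i\<in>{..m}. ?D i) \<longrightarrow> N < p (y - 0) \<omega>"
          by (rule glue_union[OF G(1), where z = h]) (use hG in auto)
        then obtain y where y: "y \<in> G" "AE \<omega> in M. \<omega> \<in> (\<Union>i\<in>{..m}. ?D i) \<longrightarrow> N < p y \<omega>"
          by auto
        have "prob (\<Union>i\<in>{..m}. ?D i) \<le> prob {\<omega>\<in>space M. N < p y \<omega>}"
          by (rule finite_measure_mono_AE) (use y(2) in \<open>auto elim!: eventually_mono\<close>)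
        with N[OF y(1)] show ?thesis by simp
      qed
      moreover have "(\<lambda>m. prob (\<Union>i\<in>{..m}. ?D i)) \<longlonglongrightarrow> prob (\<Union>m. \<Union>i\<in>{..m}. ?D i)"
        by (intro finite_Lim_measure_incseq) (auto simp: incseq_def, force)
      ultimately have "prob (\<Union>m. \<Union>i\<in>{..m}. ?D i) \<le> \<theta>"
        by (intro LIMSEQ_le_const2) auto
      moreover have "prob {\<omega>\<in>space M. X \<omega> = \<infinity>} \<le> prob (\<Union>m. \<Union>i\<in>{..m}. ?D i)"
      proof (rule finite_measure_mono)
        show "{\<omega>\<in>space M. X \<omega> = \<infinity>} \<subseteq> (\<Union>m. \<Union>i\<in>{..m}. ?D i)"
        proof
          fix \<omega> assume \<omega>: "\<omega> \<in> {\<omega>\<in>space M. X \<omega> = \<infinity>}"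
          then have "ereal N < (SUP n. ereal (p (h n) \<omega>))" by (simp add: X_def)
          then obtain n where "N < p (h n) \<omega>" by (auto simp: less_SUP_iff)
          with \<omega> show "\<omega> \<in> (\<Union>m. \<Union>i\<in>{..m}. ?D i)" by auto
        qed
      qed measurable
      ultimately show ?thesis by simp
    qed
    then have "prob {\<omega>\<in>space M. X \<omega> = \<infinity>} \<le> 0" by (rule field_le_epsilon[of _ 0, simplified])
    then have "prob {\<omega>\<in>space M. X \<omega> = \<infinity>} = 0" by (simp add: measure_le_0_iff)
    then show ?thesis by (subst (asm) prob_eq_0) (auto elim: eventually_rev_mp)
  qed
  have dom: "AE \<omega> in M. ereal (p x \<omega>) \<le> X \<omega>" if "x \<in> G" for x
  proof -
    have null: "prob {\<omega>\<in>space M. of_rat r < p x \<omega> \<and> X \<omega> \<le> ereal (of_rat r)} = 0" for r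
    proof -
      let ?E = "{\<omega>\<in>space M. of_rat r < p x \<omega> \<and> X \<omega> \<le> ereal (of_rat r)}"
      have "prob ?E \<le> 1 / real (Suc j)" for j
      proof -
        let ?D = "{\<omega>\<in>space M. of_rat r < p (g (of_rat r) j) \<omega>}"
        let ?A = "{\<omega>\<in>space M. of_rat r < p x \<omega>}"
        obtain n where n: "g (of_rat r) j = h n" using gh by blast
        have "p (h n) \<omega> \<le> real_of_rat r" if "X \<omega> \<le> ereal (of_rat r)" for \<omega>
        proof -
          have "ereal (p (h n) \<omega>) \<le> X \<omega>" unfolding X_def by (rule SUP_upper) simp
          with that have "ereal (p (h n) \<omega>) \<le> ereal (of_rat r)" by (rule order_trans[rotated])
          then show ?thesis by simp
        qed
        \<comment> \<open>A glued element of \<open>G\<close> exceeds the level on both disjoint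
          events, so their total probability is at most \<open>c\<close>; but \<open>?D\<close>
          alone falls short of \<open>c\<close> by less than \<open>1 / (j + 1)\<close>.\<close>
        then have "?D \<inter> ?E = {}" unfolding n by (force simp: not_less[symmetric])
        then have "prob ?D + prob ?E = prob (?D \<union> ?E)"
          by (intro finite_measure_Union[symmetric]) auto
        also have "\<dots> \<le> prob {\<omega>\<in>space M. of_rat r < p (glue ?A x (g (of_rat r) j)) \<omega>}"
        proof (rule finite_measure_mono_AE)
          show "AE \<omega> in M. \<omega> \<in> ?D \<union> ?E \<longrightarrow>
              \<omega> \<in> {\<omega>\<in>space M. of_rat r < p (glue ?A x (g (of_rat r) j)) \<omega>}"
            using p_glue[of ?A x "g (of_rat r) j" 0, simplified] by (auto elim!: eventually_mono)
        qed measurable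
        also have "\<dots> \<le> c (of_rat r)"
          unfolding c_def by (intro cSUP_upper bdd_c glue_in_convex G(1) that g(1)) measurable
        finally show ?thesis using g(2)[of "of_rat r" j] by linarith
      qed
      then have "prob ?E \<le> 0"
        by (intro LIMSEQ_le_const[OF LIMSEQ_inverse_real_of_nat]) (auto simp: inverse_eq_divide)
      then show ?thesis by (simp add: measure_le_0_iff)
    qed
    have "AE \<omega> in M. \<not> (of_rat r < p x \<omega> \<and> X \<omega> \<le> ereal (of_rat r))" for r
      using null[of r] by (subst (asm) prob_eq_0) (auto elim: eventually_rev_mp)
    then have "AE \<omega> in M. \<forall>r. \<not> (of_rat r < p x \<omega> \<and> X \<omega> \<le> ereal (of_rat r))"
      by (subst AE_all_countable) auto
    then show ?thesis
    proof eventually_elim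
      case (elim \<omega>)
      show ?case
      proof (rule ccontr)
        assume "\<not> ereal (p x \<omega>) \<le> X \<omega>"
        then obtain t where t: "X \<omega> < ereal t" "ereal t < ereal (p x \<omega>)"
          using ereal_dense2[of "X \<omega>" "ereal (p x \<omega>)"] by (auto simp: not_le)
        then obtain q where q: "q \<in> \<rat>" "t < q" "q < p x \<omega>" using Rats_dense_in_real[of t "p x \<omega>"] by auto
        then obtain r where "q = of_rat r" by (auto elim: Rats_cases)
        with q have "of_rat r < p x \<omega>" "ereal t < ereal (of_rat r)" by auto
        moreover from this t have "X \<omega> \<le> ereal (of_rat r)" by order
        ultimately show False using elim by blast
      qed
    qed
  qed
  show ?thesis
  proof (intro bexI ballI)
    fix x assume "x \<in> G"
    from dom[OF this] X_finite show "AE \<omega> in M. p x \<omega> \<le> real_of_ereal (X \<omega>)"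
    proof eventually_elim
      case (elim \<omega>)
      \<comment> \<open>The value \<open>-\<infinity>\<close> is excluded by the real lower bound
        \<open>p x \<omega>\<close>.\<close>
      then show ?case by (cases "X \<omega>") auto
    qed
  qed measurable
qed

lemma AE_bounded_if_compact:
  assumes G: "convexly_seq_compact G" "L0_convex M act G" "G \<noteq> {}"
  shows "\<exists>\<xi>\<in>borel_measurable M. \<forall>g\<in>G. AE \<omega> in M. p g \<omega> \<le> \<xi> \<omega>"
proof (rule AE_bounded_if_bounded_in_prob[OF G(2,3)])
  fix \<theta> :: real assume "\<theta> > 0"
  then have "\<not> unbounded_in_prob \<theta> (saturation G)"
    by (intro not_unbounded_in_prob convexly_seq_compact_saturation L0_convex_saturation
        p_closed_saturation G(1,2))
  then obtain N \<epsilon> where "\<epsilon> > 0" and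
    N: "\<And>s. s \<in> saturation G \<Longrightarrow> prob {\<omega>\<in>space M. N < p s \<omega>} \<le> \<theta> - \<epsilon>"
    by (force simp: unbounded_in_prob_def not_less)
  then show "\<exists>N. \<forall>g\<in>G. prob {\<omega>\<in>space M. N < p g \<omega>} < \<theta>"
    using subset_saturation[of G] by (intro exI[of _ N]) (smt (verit) subsetD)
qed

section \<open>Reduction to one seminorm and real scalars\<close>

text \<open>The traces of the \<open>C n\<close> on \<open>G\<close> are nested, so a finite
  intersection contains the trace with the largest index.\<close>

lemma convexly_seq_compact_if_L0_convexly_compact:
  assumes G: "L0_convexly_compact M act \<P> G" and "p \<in> \<P>"
  shows "convexly_seq_compact G"
  unfolding convexly_seq_compact_def
proof (intro allI impI, elim conjE)
  fix C :: "nat \<Rightarrow> 'e set"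
  assume dec: "decseq C" and C: "\<forall>n. L0_convex M act (C n) \<and> p_closed (C n) \<and> C n \<inter> G \<noteq> {}"
  let ?F = "range (\<lambda>n. G \<inter> C n)"
  have conv: "L0_convex M act G" using G by (simp add: L0_convexly_compact_def)
  have "\<forall>F\<in>?F. F \<subseteq> G \<and> L0_convex M act F \<and> el_closed_in M \<P> G F"
  proof
    fix F assume "F \<in> ?F"
    obtain n where n: "F = G \<inter> C n" using \<open>F \<in> ?F\<close> by auto
    have "el_closed M \<P> (C n)" using C assms(2) by (intro p_closed_imp_el_closed) auto
    then have "el_closed_in M \<P> G F" using n by (auto simp: el_closed_in_def)
    moreover have "L0_convex M act F" using n C conv by (simp add: L0_convex_Int)
    ultimately show "F \<subseteq> G \<and> L0_convex M act F \<and> el_closed_in M \<P> G F" using n by auto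
  qed
  moreover have "\<forall>\<F>. \<F> \<subseteq> ?F \<and> finite \<F> \<and> \<F> \<noteq> {} \<longrightarrow> \<Inter>\<F> \<noteq> {}"
  proof (intro allI impI)
    fix \<F> assume fin: "\<F> \<subseteq> ?F \<and> finite \<F> \<and> \<F> \<noteq> {}"
    obtain I where I: "finite I" "\<F> = (\<lambda>n. G \<inter> C n) ` I"
      using fin by (meson finite_subset_image)
    have "G \<inter> C (Max I) \<subseteq> G \<inter> C n" if "n \<in> I" for n
      using decseqD[OF dec Max_ge[OF I(1) that]] by blast
    then have "G \<inter> C (Max I) \<subseteq> \<Inter>\<F>" using I(2) by blast
    moreover have "C (Max I) \<inter> G \<noteq> {}" using C by blast
    ultimately show "\<Inter>\<F> \<noteq> {}" by blast
  qed
  ultimately have "\<Inter>?F \<noteq> {}"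
    by (rule mp[OF spec[OF conjunct2[OF G[unfolded L0_convexly_compact_def]], of ?F] conjI])
  then show "\<exists>u\<in>G. \<forall>n. u \<in> C n" by auto
qed

end

text \<open>The embedding \<open>of_real\<close> is measurable, multiplicative, additive and
  preserves the norm, so the axioms restrict.\<close>

lemma random_seminorm_real_action:
  fixes smul :: "('w \<Rightarrow> 'k::real_normed_field) \<Rightarrow> 'e::ab_group_add \<Rightarrow> 'e"
  assumes "RLC_module M smul \<P>" "p \<in> \<P>"
  shows "random_seminorm M (\<lambda>\<xi>. smul (\<lambda>\<omega>. of_real (\<xi> \<omega>))) p"
proof -
  let ?r = "\<lambda>\<xi> \<omega>. of_real (\<xi> \<omega>) :: 'k"
  have r: "?r \<xi> \<in> L0 M" if "\<xi> \<in> L0 M" for \<xi>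
    using that unfolding L0_def
    by (rule measurable_compose) (intro borel_measurable_continuous_onI continuous_intros)
  have m: "L0_module M smul" and s: "L0_seminorm M smul p" and "prob_space M"
    using assms by (auto simp: RLC_module_def)
  note mD = L0_moduleD[OF m]
  have "L0_module M (\<lambda>\<xi>. smul (?r \<xi>))"
    unfolding L0_module_def of_real_add of_real_mult of_real_1
  proof (intro conjI ballI allI impI)
    fix \<xi> \<eta> :: "'w \<Rightarrow> real" and x
    assume \<xi>: "\<xi> \<in> L0 M" and \<eta>: "\<eta> \<in> L0 M" and "AE \<omega> in M. \<xi> \<omega> = \<eta> \<omega>"
    then have "AE \<omega> in M. ?r \<xi> \<omega> = ?r \<eta> \<omega>" by (auto elim: eventually_mono)
    then show "smul (?r \<xi>) x = smul (?r \<eta>) x" by (rule mD(1)[OF r[OF \<xi>] r[OF \<eta>]])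
  next
    fix x show "smul (\<lambda>\<omega>. 1) x = x" by (rule mD(5)[of "\<lambda>_. 0"]) (simp add: L0_def)
  qed (rule mD r; assumption?)+
  moreover have "L0_seminorm M (\<lambda>\<xi>. smul (?r \<xi>)) p"
    unfolding L0_seminorm_def
  proof (intro conjI ballI allI)
    fix \<xi> :: "'w \<Rightarrow> real" and x
    assume "\<xi> \<in> L0 M"
    then have "AE \<omega> in M. p (smul (?r \<xi>) x) \<omega> = norm (?r \<xi> \<omega>) * p x \<omega>"
      using s[unfolded L0_seminorm_def, THEN conjunct2, THEN conjunct1, THEN bspec, OF r] by blast
    then show "AE \<omega> in M. p (smul (?r \<xi>) x) \<omega> = norm (\<xi> \<omega>) * p x \<omega>" by simp
  qed (use s in \<open>auto simp: L0_seminorm_def\<close>)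
  ultimately show ?thesis
    using \<open>prob_space M\<close> by (simp add: random_seminorm_def random_seminorm_axioms_def)
qed

theorem theorem3p1:
  fixes M :: "'w measure"
    and smul :: "('w \<Rightarrow> 'k::real_normed_field) \<Rightarrow> 'e::ab_group_add \<Rightarrow> 'e"
    and \<P> :: "('e \<Rightarrow> 'w \<Rightarrow> real) set"
    and G :: "'e set"
  assumes "RLC_module M smul \<P>"
    and "L0_convex M smul G"
    and "L0_convexly_compact M smul \<P> G"
  shows "\<forall>p\<in>\<P>. \<exists>\<xi>\<in>borel_measurable M. (AE \<omega> in M. 0 \<le> \<xi> \<omega>) \<and>
           (\<forall>g\<in>G. AE \<omega> in M. p g \<omega> \<le> \<xi> \<omega>)"
proof
  fix p assume p: "p \<in> \<P>"
  let ?act = "\<lambda>\<xi>. smul (\<lambda>\<omega>. of_real (\<xi> \<omega>))"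
  interpret random_seminorm M ?act p
    using assms(1) p by (rule random_seminorm_real_action)
  \<comment> \<open>The coefficients in \<open>L0_convex\<close> are real to begin with, and
    \<open>of_real\<close> on reals is the identity.\<close>
  have conv_eq: "L0_convex M ?act C \<longleftrightarrow> L0_convex M smul C" for C
    by (simp add: L0_convex_def)
  have "L0_convexly_compact M ?act \<P> G"
    using assms(3) unfolding L0_convexly_compact_def conv_eq .
  then have G: "convexly_seq_compact G" "L0_convex M ?act G"
    using convexly_seq_compact_if_L0_convexly_compact[OF _ p] assms(2) conv_eq by auto
  show "\<exists>\<xi>\<in>borel_measurable M. (AE \<omega> in M. 0 \<le> \<xi> \<omega>) \<and> (\<forall>g\<in>G. AE \<omega> in M. p g \<omega> \<le> \<xi> \<omega>)"
  proof (cases "G = {}")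
    case True
    then show ?thesis by (intro bexI[of _ "\<lambda>_. 0"]) auto
  next
    case False
    then obtain \<xi> where "\<xi> \<in> borel_measurable M" "\<forall>g\<in>G. AE \<omega> in M. p g \<omega> \<le> \<xi> \<omega>"
      using AE_bounded_if_compact[OF G] by blast
    then show ?thesis
      by (intro bexI[of _ "\<lambda>\<omega>. max 0 (\<xi> \<omega>)"]) (auto elim!: eventually_mono)
  qed
qed

end
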